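(* The Limited Packing problem (LP) is NP-hard on doubly chordal graphs.
   Context: Graphs are finite, simple, undirected; $N[v]$ is the closed neighborhood. LP: given a graph $G=(V,E)$ and an integer $k\geq 2$, compute the maximum $|B|$ over $B\subseteq V$ with $|N[v]\cap B|\leq k$ for all $v\in V$. A vertex $u\in N[v]$ is a maximum neighbor of $v$ if $N[w]\subseteq N[u]$ for every $w\in N[v]$. For an ordering $(v_1,\dots,v_n)$ of $V$, let $G_i=G[\{v_i,\dots,v_n\}]$; it is an order of maximum neighborhoods if each $v_i$ has a maximum neighbor in $G_i$. A graph is dually chordal if it admits an order of maximum neighborhoods, chordal if every cycle of length at least 4 has a chord, and doubly chordal if it is both chordal and dually chordal. *)

theory Defs
  imports "HOL-Computational_Algebra.Polynomial"
begin

section \<open>Graphs\<close>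

record 'a ugraph =
  verts :: "'a set"
  edges :: "'a set set"

definition simple_graph :: "'a ugraph \<Rightarrow> bool" where
  "simple_graph G \<longleftrightarrow> finite (verts G) \<and> (\<forall>e\<in>edges G. e \<subseteq> verts G \<and> card e = 2)"

definition closed_nbhd :: "'a ugraph \<Rightarrow> 'a \<Rightarrow> 'a set" where
  "closed_nbhd G v = {u \<in> verts G. u = v \<or> {u, v} \<in> edges G}"

definition induced_subgraph :: "'a ugraph \<Rightarrow> 'a set \<Rightarrow> 'a ugraph" where
  "induced_subgraph G S = \<lparr>verts = verts G \<inter> S, edges = {e \<in> edges G. e \<subseteq> S}\<rparr>"

definition maximum_neighbor :: "'a ugraph \<Rightarrow> 'a \<Rightarrow> 'a \<Rightarrow> bool" where
  "maximum_neighbor G v u \<longleftrightarrow>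
     u \<in> closed_nbhd G v \<and> (\<forall>w\<in>closed_nbhd G v. closed_nbhd G w \<subseteq> closed_nbhd G u)"

definition maximum_nbhd_order :: "'a ugraph \<Rightarrow> 'a list \<Rightarrow> bool" where
  "maximum_nbhd_order G vs \<longleftrightarrow> distinct vs \<and> set vs = verts G \<and>
     (\<forall>i<length vs. \<exists>u. maximum_neighbor (induced_subgraph G (set (drop i vs))) (vs ! i) u)"

definition dually_chordal :: "'a ugraph \<Rightarrow> bool" where
  "dually_chordal G \<longleftrightarrow> simple_graph G \<and> (\<exists>vs. maximum_nbhd_order G vs)"

definition is_cycle :: "'a ugraph \<Rightarrow> 'a list \<Rightarrow> bool" where
  "is_cycle G c \<longleftrightarrow> 3 \<le> length c \<and> distinct c \<and> set c \<subseteq> verts G \<and>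
     (\<forall>i<length c. {c ! i, c ! (Suc i mod length c)} \<in> edges G)"

definition has_chord :: "'a ugraph \<Rightarrow> 'a list \<Rightarrow> bool" where
  "has_chord G c \<longleftrightarrow> (\<exists>i<length c. \<exists>j<length c.
     i \<noteq> j \<and> j \<noteq> Suc i mod length c \<and> i \<noteq> Suc j mod length c \<and> {c ! i, c ! j} \<in> edges G)"

definition chordal :: "'a ugraph \<Rightarrow> bool" where
  "chordal G \<longleftrightarrow> simple_graph G \<and> (\<forall>c. is_cycle G c \<and> 4 \<le> length c \<longrightarrow> has_chord G c)"

definition doubly_chordal :: "'a ugraph \<Rightarrow> bool" where
  "doubly_chordal G \<longleftrightarrow> chordal G \<and> dually_chordal G"


section \<open>Limited packing\<close>

definition limited_packing :: "'a ugraph \<Rightarrow> nat \<Rightarrow> 'a set \<Rightarrow> bool" where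
  "limited_packing G k B \<longleftrightarrow>
     B \<subseteq> verts G \<and> (\<forall>v\<in>verts G. card (closed_nbhd G v \<inter> B) \<le> k)"

definition LP_opt :: "'a ugraph \<Rightarrow> nat \<Rightarrow> nat" where
  "LP_opt G k = Max {card B | B. limited_packing G k B}"


section \<open>Deterministic multi-tape Turing machines\<close>

text \<open>
  A machine has tapes that are infinite in both directions, the tape alphabet
  \<open>{..<symbols M}\<close> and the non-halting control states \<open>{..<states M}\<close>. State \<open>0\<close> is initial
  and state \<open>states M\<close> is the halting state. Symbol \<open>0\<close> is the blank, symbols \<open>1\<close> and \<open>2\<close>
  are the bits \<open>False\<close> and \<open>True\<close>. The input is on the first tape and the output on the last.
\<close>

datatype move = Left_Move | No_Move | Right_Move

record tm =
  tapes :: nat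
  symbols :: nat
  states :: nat
  delta :: "nat \<Rightarrow> nat list \<Rightarrow> nat \<times> (nat \<times> move) list"

definition turing_machine :: "tm \<Rightarrow> bool" where
  "turing_machine M \<longleftrightarrow> 1 \<le> tapes M \<and> 3 \<le> symbols M \<and>
     (\<forall>q<states M. \<forall>rs. length rs = tapes M \<and> set rs \<subseteq> {..<symbols M} \<longrightarrow>
        (case delta M q rs of (q', as) \<Rightarrow>
           q' \<le> states M \<and> length as = tapes M \<and> (\<forall>(a, m)\<in>set as. a < symbols M)))"

text \<open>A tape is its content together with the position of the head.\<close>

type_synonym tape = "(int \<Rightarrow> nat) \<times> int"
type_synonym config = "nat \<times> tape list"

fun head_shift :: "move \<Rightarrow> int" where
  "head_shift Left_Move = -1"
| "head_shift No_Move = 0"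
| "head_shift Right_Move = 1"

definition read_tape :: "tape \<Rightarrow> nat" where
  "read_tape = (\<lambda>(c, h). c h)"

definition act_tape :: "nat \<times> move \<Rightarrow> tape \<Rightarrow> tape" where
  "act_tape = (\<lambda>(a, m) (c, h). (c(h := a), h + head_shift m))"

definition tm_step :: "tm \<Rightarrow> config \<Rightarrow> config" where
  "tm_step M = (\<lambda>(q, ts).
     if q < states M
     then (case delta M q (map read_tape ts) of (q', as) \<Rightarrow> (q', map2 act_tape as ts))
     else (q, ts))"

definition content_of :: "bool list \<Rightarrow> int \<Rightarrow> nat" where
  "content_of x i = (if 0 \<le> i \<and> i < int (length x) then (if x ! nat i then 2 else 1) else 0)"

definition tm_init :: "tm \<Rightarrow> bool list \<Rightarrow> config" where
  "tm_init M x = (0, (content_of x, 0) # replicate (tapes M - 1) (content_of [], 0))"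

definition tm_computes_within :: "tm \<Rightarrow> bool list \<Rightarrow> bool list \<Rightarrow> nat \<Rightarrow> bool" where
  "tm_computes_within M x y t \<longleftrightarrow>
     (case (tm_step M ^^ t) (tm_init M x) of (q, ts) \<Rightarrow>
        q = states M \<and> fst (last ts) = content_of y)"


section \<open>Polynomial time and NP-hardness\<close>

definition polytime :: "(bool list \<Rightarrow> bool list) \<Rightarrow> bool" where
  "polytime f \<longleftrightarrow> (\<exists>M (p :: nat poly). turing_machine M \<and>
     (\<forall>x. tm_computes_within M x (f x) (poly p (length x))))"

definition class_P :: "bool list set set" where
  "class_P = {A. polytime (\<lambda>x. [x \<in> A])}"

text \<open>A self-delimiting pairing: every bit of the first component is preceded by \<open>True\<close>.\<close>

definition pair_code :: "bool list \<Rightarrow> bool list \<Rightarrow> bool list" where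
  "pair_code x y = concat (map (\<lambda>b. [True, b]) x) @ False # y"

definition class_NP :: "bool list set set" where
  "class_NP = {A. \<exists>R\<in>class_P. \<exists>p :: nat poly.
     \<forall>x. x \<in> A \<longleftrightarrow> (\<exists>y. length y \<le> poly p (length x) \<and> pair_code x y \<in> R)}"

text \<open>
  A decision problem is given by its set of (codes of) instances and its set of (codes of)
  yes-instances. A reduction may only produce codes of instances of the problem, so the
  hardness of a problem restricted to a graph class never exploits malformed strings or
  graphs outside the class.
\<close>

definition NP_hard :: "bool list set \<Rightarrow> bool list set \<Rightarrow> bool" where
  "NP_hard Inst Yes \<longleftrightarrow> (\<forall>A\<in>class_NP. \<exists>f. polytime f \<and>
     (\<forall>x. f x \<in> Inst \<and> (x \<in> A \<longleftrightarrow> f x \<in> Yes)))"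


section \<open>Limited packing as a decision problem\<close>

text \<open>Binary representation, least significant bit first.\<close>

fun nat_code :: "nat \<Rightarrow> bool list" where
  "nat_code n = (if n = 0 then [] else odd n # nat_code (n div 2))"

declare nat_code.simps [simp del]

text \<open>Graphs with vertex set \<open>{..<n}\<close> are coded by \<open>n\<close> and their adjacency matrix.\<close>

definition graph_code :: "nat ugraph \<Rightarrow> bool list" where
  "graph_code G = (let n = card (verts G) in
     pair_code (nat_code n) [{i, j} \<in> edges G. i \<leftarrow> [0..<n], j \<leftarrow> [0..<n]])"

definition LP_code :: "nat ugraph \<Rightarrow> nat \<Rightarrow> nat \<Rightarrow> bool list" where
  "LP_code G k s = pair_code (nat_code k) (pair_code (nat_code s) (graph_code G))"

text \<open>
  The decision version of the maximisation problem, restricted to the graph class \<open>C\<close>: given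
  \<open>G\<close>, \<open>k \<ge> 2\<close> and a threshold \<open>s\<close>, is the maximum size of a packing at least \<open>s\<close>?
\<close>

definition LP_instances :: "(nat ugraph \<Rightarrow> bool) \<Rightarrow> bool list set" where
  "LP_instances C = {LP_code G k s | G k s.
     simple_graph G \<and> (\<exists>n. verts G = {..<n}) \<and> C G \<and> 2 \<le> k}"

definition LP_yes_instances :: "(nat ugraph \<Rightarrow> bool) \<Rightarrow> bool list set" where
  "LP_yes_instances C = {LP_code G k s | G k s.
     simple_graph G \<and> (\<exists>n. verts G = {..<n}) \<and> C G \<and> 2 \<le> k \<and> s \<le> LP_opt G k}"

end

theory Submission
  imports Defs
begin

text \<open>
  Let \<open>C\<close> be a relation on \<open>{..<m}\<close>. Take a clique consisting of a hub \<open>u\<close> and one vertex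
  \<open>v\<^sub>i\<^sub>j\<close> for every pair of elements, join \<open>u\<close> to all elements, \<open>v\<^sub>i\<^sub>j\<close> to \<open>i\<close> and, if \<open>C i j\<close>, to
  \<open>j\<close>, and attach \<open>k - 1\<close> pendant leaves to every \<open>v\<^sub>i\<^sub>j\<close>. This is a split graph with leaves, hence
  chordal; eliminating the leaves first and then everything else with maximum neighbor \<open>u\<close>
  shows that it is dually chordal. The hub sees everything but the leaves, so a packing of size
  \<open>k + m\<^sup>2 (k - 1)\<close> contains all leaves and exactly \<open>k\<close> other vertices; the leaves leave room for only one
  of these in each \<open>N[v\<^sub>i\<^sub>j]\<close>, so they are \<open>k\<close> elements no two of which are related by \<open>C\<close>.

  A computation of a verifier is a binary constraint satisfaction problem whose variables are
  the tape cells addressed by time and by offset from the heads. With elements the pairs of a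
  variable and a value, and \<open>C\<close> the violation of a constraint, the \<open>C\<close>-free sets with one element
  per variable are the accepting computations.

  The adjacency matrix of the graph is definable from the input by terms built from
  arithmetic, bounded sums and access to the input bits. Such terms are evaluated in polynomial time
  by programs with unary counters, and a counter is a Turing machine tape whose
  head position is its value.
\<close>

section \<open>Counter programs with finite control: small-step semantics on continuation
  stacks\<close>

section \<open>Counter programs\<close>

datatype cmd = Inc nat | Dec nat | IncIf nat nat | InMove move | OutBit nat | Seq cmd cmd | While nat cmd

type_synonym store = "int \<times> (nat \<Rightarrow> nat) \<times> bool list"

text \<open>Continuation stacks instead of a big-step semantics: every command costs one step, to be
  matched by one machine step, and the stacks become control states, because only finitely many of
  them occur (\<open>finite_conts\<close>).\<close>

fun cstep :: "bool list \<Rightarrow> cmd list \<times> store \<Rightarrow> cmd list \<times> store" where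
  "cstep x ([], s) = ([], s)"
| "cstep x (Inc r # k, p, s, out) = (k, p, s(r := Suc (s r)), out)"
| "cstep x (Dec r # k, p, s, out) = (k, p, s(r := s r - 1), out)"
| "cstep x (IncIf a r # k, p, s, out) = (k, p, s(r := (if content_of x p = a then Suc (s r) else s r)), out)"
| "cstep x (InMove m # k, p, s, out) = (k, p + head_shift m, s, out)"
| "cstep x (OutBit r # k, p, s, out) = (k, p, s, out @ [s r \<noteq> 0])"
| "cstep x (Seq a b # k, p, s, out) = (a # b # k, p, s, out)"
| "cstep x (While r c # k, p, s, out) = ((if s r = 0 then k else c # While r c # k), p, s, out)"

primrec reg_bound :: "cmd \<Rightarrow> nat" where
  "reg_bound (Inc r) = Suc r"
| "reg_bound (Dec r) = Suc r"
| "reg_bound (IncIf a r) = Suc r"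
| "reg_bound (InMove m) = 0"
| "reg_bound (OutBit r) = Suc r"
| "reg_bound (Seq a b) = max (reg_bound a) (reg_bound b)"
| "reg_bound (While r c) = max (Suc r) (reg_bound c)"

text \<open>The nonempty continuation stacks that occur while \<open>c\<close> is executed on top of \<open>k\<close>.\<close>

primrec conts :: "cmd \<Rightarrow> cmd list \<Rightarrow> cmd list set" where
  "conts (Inc r) k = {Inc r # k}"
| "conts (Dec r) k = {Dec r # k}"
| "conts (IncIf a r) k = {IncIf a r # k}"
| "conts (InMove m) k = {InMove m # k}"
| "conts (OutBit r) k = {OutBit r # k}"
| "conts (Seq a b) k = insert (Seq a b # k) (conts a (b # k) \<union> conts b k)"
| "conts (While r c) k = insert (While r c # k) (conts c (While r c # k))"

lemma finite_conts: "finite (conts c k)"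
  by (induction c arbitrary: k) auto

lemma conts_self: "c # k \<in> conts c k"
  by (cases c) auto

lemma Nil_notin_conts: "[] \<notin> conts c k"
  by (induction c arbitrary: k) auto

text \<open>A loop pushes itself below its body and is popped again, so stacks do not grow with the
  number of iterations. Started on \<open>[c]\<close>, the program stays in the finite set
  \<open>conts c []\<close> until the stack is empty.\<close>

lemma conts_closed:
  "l \<in> conts c k \<Longrightarrow> fst (cstep x (l, st)) \<in> insert k (conts c k)"
proof (induction c arbitrary: k)
  case (Seq a b)
  then consider "l = Seq a b # k" | "l \<in> conts a (b # k)" | "l \<in> conts b k" by auto
  then show ?case
    by cases (cases st, use Seq.IH[of "b # k"] Seq.IH(2)[of k] conts_self in auto)
next
  case (While r c)
  then consider "l = While r c # k" | "l \<in> conts c (While r c # k)" by auto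
  then show ?case
    by cases (cases st, use While.IH[of "While r c # k"] conts_self in auto)
qed (cases st, simp)+

text \<open>Bounds the number of register tapes: no command on a reachable stack uses a register
  that does not occur in the program.\<close>

lemma conts_bound:
  assumes "l \<in> conts c k" "reg_bound c \<le> N" "\<And>d. d \<in> set k \<Longrightarrow> reg_bound d \<le> N"
  shows "d \<in> set l \<Longrightarrow> reg_bound d \<le> N"
  using assms
proof (induction c arbitrary: k)
  case (Seq a b)
  then consider "l = Seq a b # k" | "l \<in> conts a (b # k)" | "l \<in> conts b k" by auto
  then show ?case
  proof cases
    case 2
    then show ?thesis using Seq.IH(1)[of "b # k"] Seq.prems by (metis max.bounded_iff reg_bound.simps(6) set_ConsD)
  next
    case 3
    then show ?thesis using Seq.IH(2)[of k] Seq.prems by simp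
  qed (use Seq.prems in auto)
next
  case (While r c)
  then consider "l = While r c # k" | "l \<in> conts c (While r c # k)" by auto
  then show ?case
  proof cases
    case 2
    then show ?thesis using While.IH[of "While r c # k"] While.prems
      by (metis max.bounded_iff reg_bound.simps(7) set_ConsD)
  qed (use While.prems in auto)
qed auto

section \<open>A Turing machine that runs a counter program in lockstep\<close>

subsection \<open>Simulation by a Turing machine\<close>

text \<open>The control part of \<open>cstep\<close>, as a function of the scanned symbols only.
  Tape \<open>0\<close> is the input, so register \<open>r\<close> is on tape \<open>Suc r\<close>,
  and its head scans the mark \<open>1\<close> exactly when the register is zero.\<close>

definition next_conts :: "cmd \<Rightarrow> cmd list \<Rightarrow> nat list \<Rightarrow> cmd list" where
  "next_conts c k rs = (case c of Seq a b \<Rightarrow> a # b # k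
     | While r d \<Rightarrow> if rs ! Suc r = 1 then k else d # While r d # k | _ \<Rightarrow> k)"

definition reg_move :: "cmd \<Rightarrow> nat list \<Rightarrow> nat \<Rightarrow> move" where
  "reg_move c rs r = (case c of Inc r' \<Rightarrow> if r = r' then Right_Move else No_Move
     | Dec r' \<Rightarrow> if r = r' \<and> rs ! Suc r \<noteq> 1 then Left_Move else No_Move
     | IncIf a r' \<Rightarrow> if r = r' \<and> rs ! 0 = a then Right_Move else No_Move
     | _ \<Rightarrow> No_Move)"

definition in_move :: "cmd \<Rightarrow> move" where
  "in_move c = (case c of InMove m \<Rightarrow> m | _ \<Rightarrow> No_Move)"

definition out_act :: "cmd \<Rightarrow> nat list \<Rightarrow> nat \<times> move" where
  "out_act c rs = (case c of OutBit r \<Rightarrow> (if rs ! Suc r = 1 then 1 else 2, Right_Move) | _ \<Rightarrow> (0, No_Move))"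

text \<open>
  A register is a tape with a single mark at position \<open>0\<close>; its value is the head position.
  State \<open>0\<close> writes the marks.
\<close>

definition counter_tm :: "nat \<Rightarrow> nat \<Rightarrow> (cmd list \<Rightarrow> nat) \<Rightarrow> (nat \<Rightarrow> cmd list) \<Rightarrow> cmd \<Rightarrow> tm" where
  "counter_tm N S enc dec c = \<lparr>tapes = N + 2, symbols = 3, states = S,
     delta = (\<lambda>q rs. if q = 0
       then (enc [c], (rs ! 0, No_Move) # map (\<lambda>r. (1, No_Move)) [0..<N] @ [(0, No_Move)])
       else (enc (next_conts (hd (dec q)) (tl (dec q)) rs),
             (rs ! 0, in_move (hd (dec q))) #
             map (\<lambda>r. (rs ! Suc r, reg_move (hd (dec q)) rs r)) [0..<N] @ [out_act (hd (dec q)) rs]))\<rparr>"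

definition reg_tape :: "nat \<Rightarrow> tape" where
  "reg_tape v = (\<lambda>i. if i = 0 then 1 else 0, int v)"

definition counter_tapes :: "bool list \<Rightarrow> nat \<Rightarrow> store \<Rightarrow> tape list" where
  "counter_tapes x N = (\<lambda>(p, s, out). (content_of x, p) # map (\<lambda>r. reg_tape (s r)) [0..<N] @
     [(content_of out, int (length out))])"

text \<open>The output head always rests on the first blank after the output, so writing a bit there
  appends it.\<close>

lemma content_of_append:
  "(content_of out)(int (length out) := (if b then 2 else 1)) = content_of (out @ [b])"
  by (auto simp: content_of_def fun_eq_iff nth_append nat_less_iff)

lemma content_of_end [simp]: "content_of out (int (length out)) = 0"
  by (simp add: content_of_def)

lemma read_reg_tape [simp]: "read_tape (reg_tape v) = (if v = 0 then 1 else 0)"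
  by (simp add: read_tape_def reg_tape_def)

lemma read_counter_tapes:
  "map read_tape (counter_tapes x N (p, s, out)) =
     content_of x p # map (\<lambda>r. if s r = 0 then 1 else 0) [0..<N] @ [0]"
  by (simp add: counter_tapes_def o_def) (simp add: read_tape_def)

lemma act_reg_tape:
  "act_tape (if v = 0 then 1 else 0, m) (reg_tape v) =
     (\<lambda>i. if i = 0 then 1 else 0, int v + head_shift m)"
  by (auto simp: act_tape_def reg_tape_def)

text \<open>Case analysis on the command, done separately for the control (\<open>A\<close>), the
  input tape (\<open>B\<close>), the register tapes (\<open>C\<close>) and the output tape
  (\<open>D\<close>).\<close>

lemma tm_step_counter:
  assumes "reg_bound c \<le> N" and dec: "dec (enc (c # k)) = c # k"
    and enc: "0 < enc (c # k)" "enc (c # k) < S"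
  shows "tm_step (counter_tm N S enc dec c0) (enc (c # k), counter_tapes x N st) =
     (case cstep x (c # k, st) of (k', st') \<Rightarrow> (enc k', counter_tapes x N st'))"
proof -
  obtain p s out where st: "st = (p, s, out)" by (cases st)
  define rs where "rs = content_of x p # map (\<lambda>r. if s r = 0 then 1 else 0 :: nat) [0..<N] @ [0]"
  have rs0: "rs ! 0 = content_of x p" by (simp add: rs_def)
  have rsS: "rs ! Suc r = (if s r = 0 then 1 else 0)" if "r < N" for r
    using that by (simp add: rs_def nth_append)
  obtain k' p' s' out' where c': "cstep x (c # k, p, s, out) = (k', p', s', out')"
    by (metis prod_cases4)
  have A: "next_conts c k rs = k'"
    using c' assms(1) rsS by (cases c) (auto simp: next_conts_def)
  have B: "act_tape (content_of x p, in_move c) (content_of x, p) = (content_of x, p')"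
    using c' by (cases c) (auto simp: act_tape_def in_move_def)
  have C: "act_tape (rs ! Suc r, reg_move c rs r) (reg_tape (s r)) = reg_tape (s' r)" if "r < N" for r
    unfolding rsS[OF that] act_reg_tape
    using c' rsS[OF that] rs0 by (cases c) (auto simp: reg_move_def reg_tape_def)
  have D: "act_tape (out_act c rs) (content_of out, int (length out)) = (content_of out', int (length out'))"
    using c' assms(1) rsS content_of_append[of out True] content_of_append[of out False]
    by (cases c) (auto simp: act_tape_def out_act_def fun_upd_idem)
  have "tm_step (counter_tm N S enc dec c0) (enc (c # k), counter_tapes x N st) =
     (enc k', map2 act_tape ((rs ! 0, in_move c) #
         map (\<lambda>r. (rs ! Suc r, reg_move c rs r)) [0..<N] @ [out_act c rs]) (counter_tapes x N (p, s, out)))"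
    unfolding tm_step_def counter_tm_def using enc dec A
    by (simp add: st read_counter_tapes flip: rs_def)
  also have "map2 act_tape ((rs ! 0, in_move c) #
         map (\<lambda>r. (rs ! Suc r, reg_move c rs r)) [0..<N] @ [out_act c rs]) (counter_tapes x N (p, s, out))
      = counter_tapes x N (p', s', out')"
    unfolding counter_tapes_def using B C D by (simp add: rs0 map2_map_map)
  finally show ?thesis using c' st by simp
qed

text \<open>Quantifying over all continuations \<open>k\<close> makes the relation compositional.
  \<open>T\<close> is only an upper bound, so time bounds can be rounded up.\<close>

definition exec :: "bool list \<Rightarrow> cmd \<Rightarrow> store \<Rightarrow> store \<Rightarrow> nat \<Rightarrow> bool" where
  "exec x c s s' T \<longleftrightarrow> (\<exists>t\<le>T. \<forall>k. (cstep x ^^ t) (c # k, s) = (k, s'))"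

text \<open>The interface to Turing machines: from here on polynomial time is established by
  counting steps of counter programs.\<close>

theorem polytime_counter:
  assumes ex: "\<And>x. \<exists>p s. exec x c (0, (\<lambda>_. 0), []) (p, s, f x) (poly q (length x))"
  shows "polytime f"
proof -
  define N where "N = reg_bound c"
  define C where "C = conts c []"
  have finC: "finite C" by (simp add: C_def finite_conts)
  obtain e where e: "bij_betw e C {0..<card C}"
    using ex_bij_betw_finite_nat[OF finC] by auto
  \<comment> \<open>Number \<open>0\<close> is kept for the initial state that writes the marks,
    \<open>1\<close> to \<open>card C\<close> are the nonempty stacks, and \<open>S\<close>, the
    code of the empty stack, is the halting state.\<close>
  define S where "S = Suc (card C)"
  define enc where "enc k = (if k = [] then S else Suc (e k))" for k
  define dec where "dec n = the_inv_into C e (n - 1)" for n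
  have enc_C: "0 < enc k" "enc k < S" "dec (enc k) = k" if "k \<in> C" for k
  proof -
    have "k \<noteq> []" using that Nil_notin_conts C_def by blast
    moreover have "e k < card C" using bij_betwE[OF e] that by auto
    ultimately show "0 < enc k" "enc k < S" "dec (enc k) = k"
      using e that by (auto simp: enc_def S_def dec_def bij_betw_def the_inv_into_f_f)
  qed
  have dec_C: "dec n \<in> C" if "0 < n" "n < S" for n
    using bij_betwE[OF bij_betw_the_inv_into[OF e]] that by (auto simp: dec_def S_def)
  have clos: "fst (cstep x (k, st)) \<in> insert [] C" if "k \<in> insert [] C" for k x st
    using that conts_closed[of k c "[]" x st] by (cases "k = []") (auto simp: C_def)
  have bnd: "\<forall>d\<in>set k. reg_bound d \<le> N" if "k \<in> C" for k
    using conts_bound[of k c "[]" N] that by (simp add: C_def N_def)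
  have enc_le: "enc k \<le> S" if "k \<in> insert [] C" for k
    using that enc_C[of k] by (auto simp: enc_def)
  let ?M = "counter_tm N S enc dec c"
  have c_in: "[c] \<in> C" by (simp add: C_def conts_self)
  have next_in: "next_conts d k rs \<in> insert [] C" if "d # k \<in> C" for d k rs
  proof (cases d)
    case (While r b)
    \<comment> \<open>The transition function must be well-formed for all symbols, also for those no
      run produces. Both branches of the loop test are realised by a real store, with all registers
      \<open>0\<close> or all \<open>1\<close>.\<close>
    have "fst (cstep [] (d # k, 0, (\<lambda>_. 0), [])) \<in> insert [] C" "fst (cstep [] (d # k, 0, (\<lambda>_. 1), [])) \<in> insert [] C"
      using clos that by blast+
    then show ?thesis using While by (auto simp: next_conts_def)
  qed (use clos[of "d # k" "[]" "(0, (\<lambda>_. 0), [])"] that in \<open>auto simp: next_conts_def\<close>)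
  have tm: "turing_machine ?M"
    unfolding turing_machine_def
  proof (intro conjI allI impI)
    fix q rs assume q: "q < states ?M" and "length rs = tapes ?M \<and> set rs \<subseteq> {..<symbols ?M}"
    then have rs: "length rs = N + 2" "\<And>i. i < N + 2 \<Longrightarrow> rs ! i < 3"
      by (auto simp: counter_tm_def subset_eq all_set_conv_all_nth)
    have out: "fst (out_act d rs) < 3" for d
      by (cases d) (auto simp: out_act_def)
    show "case delta ?M q rs of (q', as) \<Rightarrow>
           q' \<le> states ?M \<and> length as = tapes ?M \<and> (\<forall>(a, m)\<in>set as. a < symbols ?M)"
    proof (cases "q = 0")
      case True
      then show ?thesis using enc_le[of "[c]"] c_in rs by (auto simp: counter_tm_def)
    next
      case False
      then have "dec q \<in> C" using dec_C q by (auto simp: counter_tm_def)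
      moreover then have "dec q \<noteq> []" using Nil_notin_conts C_def by metis
      ultimately have "next_conts (hd (dec q)) (tl (dec q)) rs \<in> insert [] C"
        by (intro next_in) simp
      from enc_le[OF this] show ?thesis using False rs out[of "hd (dec q)"]
        by (simp add: counter_tm_def split_beta)
    qed
  qed (simp_all add: counter_tm_def)
  have sim: "(tm_step ?M ^^ t) (enc k, counter_tapes x N st) =
      (case (cstep x ^^ t) (k, st) of (k', st') \<Rightarrow> (enc k', counter_tapes x N st'))"
    if "k \<in> insert [] C" for t k st x
    using that
  proof (induction t arbitrary: k st)
    case (Suc t)
    obtain k' st' where c': "cstep x (k, st) = (k', st')" by (meson surj_pair)
    have "k' \<in> insert [] C" using clos[OF Suc.prems, of x st] c' by simp
    moreover have "tm_step ?M (enc k, counter_tapes x N st) = (enc k', counter_tapes x N st')"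
    proof (cases k)
      case Nil
      then show ?thesis using c' by (auto simp: tm_step_def counter_tm_def enc_def)
    next
      case (Cons d l)
      then have "k \<in> C" using Suc.prems by auto
      then show ?thesis using tm_step_counter[of d N dec enc l S c x st] enc_C[of k] bnd[of k] Cons c' by simp
    qed
    ultimately show ?case using Suc.IH c' by (simp add: funpow_Suc_right del: funpow.simps)
  qed simp
  have init: "tm_step ?M (tm_init ?M x) = (enc [c], counter_tapes x N (0, (\<lambda>_. 0), []))" for x
  proof -
    have r: "replicate (Suc N) (content_of [], 0::int) =
        map (\<lambda>_. (content_of [], 0)) [0..<N] @ [(content_of [], 0)]"
      by (simp add: map_replicate_const replicate_append_same)
    have e: "content_of [] = (\<lambda>_. 0)" by (auto simp: content_of_def)
    show ?thesis
      unfolding tm_step_def tm_init_def counter_tm_def counter_tapes_def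
      by (simp add: S_def r map2_map_map read_tape_def del: replicate_Suc)
        (auto simp: act_tape_def e reg_tape_def)
  qed
  \<comment> \<open>The summand \<open>1\<close> pays for writing the marks. A run that ends early
    idles on the empty stack, so the configuration at the full time bound is still the final
    one.\<close>
  have fin: "tm_computes_within ?M x (f x) (poly (q + 1) (length x))" for x
  proof -
    obtain p s where "exec x c (0, (\<lambda>_. 0), []) (p, s, f x) (poly q (length x))" using ex by blast
    then obtain t where t: "t \<le> poly q (length x)" "(cstep x ^^ t) ([c], 0, (\<lambda>_. 0), []) = ([], p, s, f x)"
      unfolding exec_def by blast
    have idem: "(cstep x ^^ n) ([], st) = ([], st)" for n st by (induction n) auto
    have "(cstep x ^^ (poly q (length x) - t + t)) ([c], 0, (\<lambda>_. 0), []) = ([], p, s, f x)"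
      unfolding funpow_add using t(2) idem by simp
    then have "(cstep x ^^ poly q (length x)) ([c], 0, (\<lambda>_. 0), []) = ([], p, s, f x)"
      using t(1) by simp
    then have "(tm_step ?M ^^ (Suc (poly q (length x)))) (tm_init ?M x) = (S, counter_tapes x N (p, s, f x))"
      using sim[of "[c]" "poly q (length x)" x] c_in by (simp add: funpow_Suc_right init enc_def del: funpow.simps)
    moreover have "last (counter_tapes x N (p, s, f x)) = (content_of (f x), int (length (f x)))"
      by (simp add: counter_tapes_def)
    ultimately show ?thesis unfolding tm_computes_within_def by (simp add: counter_tm_def)
  qed
  show ?thesis unfolding polytime_def using tm fin by blast
qed


section \<open>Running times of sequences, loops and register idioms\<close>

subsection \<open>Timed execution\<close>

lemma exec_mono: "exec x c s s' T \<Longrightarrow> T \<le> T' \<Longrightarrow> exec x c s s' T'"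
  unfolding exec_def by (meson order_trans)

lemma exec_eqI: "exec x c s s1 T1 \<Longrightarrow> s1 = s' \<Longrightarrow> T1 \<le> T \<Longrightarrow> exec x c s s' T"
  using exec_mono by blast

lemma exec_atom:
  assumes "\<And>k. cstep x (c # k, s) = (k, s')"
  shows "exec x c s s' 1"
  unfolding exec_def using assms by (intro exI[of _ 1]) simp

lemma exec_Inc: "exec x (Inc r) (p, s, out) (p, s(r := Suc (s r)), out) 1"
  and exec_Dec: "exec x (Dec r) (p, s, out) (p, s(r := s r - 1), out) 1"
  and exec_IncIf: "exec x (IncIf a r) (p, s, out)
    (p, s(r := (if content_of x p = a then Suc (s r) else s r)), out) 1"
  and exec_InMove: "exec x (InMove m) (p, s, out) (p + head_shift m, s, out) 1"
  and exec_OutBit: "exec x (OutBit r) (p, s, out) (p, s, out @ [s r \<noteq> 0]) 1"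
  by (rule exec_atom, simp)+

lemma exec_Seq:
  assumes "exec x a s s1 T1" "exec x b s1 s2 T2"
  shows "exec x (Seq a b) s s2 (T1 + T2 + 1)"
proof -
  obtain t1 t2 where t: "t1 \<le> T1" "\<And>k. (cstep x ^^ t1) (a # k, s) = (k, s1)"
    "t2 \<le> T2" "\<And>k. (cstep x ^^ t2) (b # k, s1) = (k, s2)"
    using assms unfolding exec_def by blast
  have "(cstep x ^^ (t2 + t1 + 1)) (Seq a b # k, s) = (k, s2)" for k
    unfolding funpow_add using t by (cases s) simp
  then show ?thesis unfolding exec_def using t by (intro exI[of _ "t2 + t1 + 1"]) auto
qed

lemma exec_While_zero: "s r = 0 \<Longrightarrow> exec x (While r c) (p, s, out) (p, s, out) 1"
  by (rule exec_atom) simp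

lemma exec_While_step:
  assumes "s r \<noteq> 0" "exec x c (p, s, out) s1 T1" "exec x (While r c) s1 s2 T2"
  shows "exec x (While r c) (p, s, out) s2 (T1 + T2 + 1)"
proof -
  obtain t1 t2 where t: "t1 \<le> T1" "\<And>k. (cstep x ^^ t1) (c # k, p, s, out) = (k, s1)"
    "t2 \<le> T2" "\<And>k. (cstep x ^^ t2) (While r c # k, s1) = (k, s2)"
    using assms unfolding exec_def by blast
  have "(cstep x ^^ (t2 + t1 + 1)) (While r c # k, p, s, out) = (k, s2)" for k
    unfolding funpow_add using t assms(1) by simp
  then show ?thesis unfolding exec_def using t by (intro exI[of _ "t2 + t1 + 1"]) auto
qed

text \<open>\<open>P\<close>, \<open>S\<close> and \<open>F\<close> give the configuration after
  \<open>j\<close> rounds. The induction is on the number of rounds still to go.\<close>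

lemma exec_While:
  assumes "\<And>j. j < n \<Longrightarrow> exec x c (P j, S j, F j) (P (Suc j), S (Suc j), F (Suc j)) T"
    and "\<And>j. j < n \<Longrightarrow> S j r \<noteq> 0" and "S n r = 0"
  shows "exec x (While r c) (P 0, S 0, F 0) (P n, S n, F n) (n * (T + 1) + 1)"
proof -
  have "exec x (While r c) (P (n - j), S (n - j), F (n - j)) (P n, S n, F n) (j * (T + 1) + 1)" if "j \<le> n" for j
    using that
  proof (induction j)
    case 0
    then show ?case using exec_While_zero[of "S n" r] assms(3) by simp
  next
    case (Suc j)
    then have n: "Suc (n - Suc j) = n - j" "n - Suc j < n" by auto
    have "exec x (While r c) (P (n - Suc j), S (n - Suc j), F (n - Suc j)) (P n, S n, F n) (T + (j * (T + 1) + 1) + 1)"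
    proof (rule exec_While_step)
      show "exec x c (P (n - Suc j), S (n - Suc j), F (n - Suc j)) (P (n - j), S (n - j), F (n - j)) T"
        using assms(1)[OF n(2)] n(1) by simp
    qed (use assms(2)[OF n(2)] Suc in simp_all)
    then show ?case by (rule exec_mono) simp
  qed
  from this[of n] show ?thesis by simp
qed

text \<open>The counted loop behind most of the compiled code: \<open>r\<close> counts down while
  \<open>S\<close> describes the other registers; whatever \<open>S\<close> says at \<open>r\<close>
  is overwritten.\<close>

lemma exec_drain:
  assumes body: "\<And>j. j < n \<Longrightarrow> exec x c (P j, (S j)(r := n - Suc j), F j)
      (P (Suc j), (S (Suc j))(r := n - Suc j), F (Suc j)) T"
    and st: "(S 0)(r := n) = s" "P 0 = p" "F 0 = out"
  shows "exec x (While r (Seq (Dec r) c)) (p, s, out) (P n, (S n)(r := 0), F n) (n * (T + 3) + 1)"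
proof -
  have "exec x (Seq (Dec r) c) (P j, (S j)(r := n - j), F j)
      (P (Suc j), (S (Suc j))(r := n - Suc j), F (Suc j)) (1 + T + 1)" if "j < n" for j
    by (rule exec_Seq[OF exec_Dec]) (use body[OF that] in simp)
  then have "exec x (While r (Seq (Dec r) c)) (P 0, (S 0)(r := n - 0), F 0)
      (P n, (S n)(r := n - n), F n) (n * (1 + T + 1 + 1) + 1)"
    by (rule exec_While) auto
  then show ?thesis using st by (simp add: add.commute numeral_3_eq_3)
qed

lemma exec_clear: "exec x (While r (Dec r)) (p, s, out) (p, s(r := 0), out) (s r * 2 + 1)"
proof -
  have "exec x (While r (Dec r)) ((\<lambda>_. p) (0 :: nat), (\<lambda>j. s(r := s r - j)) 0, (\<lambda>_. out) (0 :: nat))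
      ((\<lambda>_. p) (s r), (\<lambda>j. s(r := s r - j)) (s r), (\<lambda>_. out) (s r)) (s r * (1 + 1) + 1)"
    by (rule exec_While) (auto intro!: exec_eqI[OF exec_Dec])
  then show ?thesis by (simp add: mult_2_right)
qed

lemma exec_move_reg:
  assumes "r \<noteq> d"
  shows "exec x (While r (Seq (Dec r) (Inc d))) (p, s, out) (p, s(d := s d + s r, r := 0), out) (s r * 4 + 1)"
proof -
  have "exec x (While r (Seq (Dec r) (Inc d))) (p, s, out)
      ((\<lambda>_. p) (s r), ((\<lambda>j. s(d := s d + j)) (s r))(r := 0), (\<lambda>_. out) (s r)) (s r * (1 + 3) + 1)"
    by (rule exec_drain) (use assms in \<open>auto intro!: exec_eqI[OF exec_Inc]\<close>)
  then show ?thesis by simp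
qed

text \<open>Every excursion of the input head is recorded in a register, which then leads the head
  back to position \<open>0\<close>.\<close>

lemma exec_rewind:
  assumes "p = int (s r)"
  shows "exec x (While r (Seq (Dec r) (InMove Left_Move))) (p, s, out) (0, s(r := 0), out) (s r * 4 + 1)"
proof -
  have "exec x (While r (Seq (Dec r) (InMove Left_Move))) (p, s, out)
      ((\<lambda>j. p - int j) (s r), ((\<lambda>j. s) (s r))(r := 0), (\<lambda>_. out) (s r)) (s r * (1 + 3) + 1)"
    by (rule exec_drain) (auto intro!: exec_eqI[OF exec_InMove])
  then show ?thesis using assms by simp
qed

section \<open>Arithmetic terms over the input and their compilation\<close>

subsection \<open>Terms\<close>

text \<open>Variables are de Bruijn indices: \<open>Sum a b\<close> binds index \<open>0\<close> in
  \<open>b\<close>. With truncated subtraction and bounded sums, comparisons, Boolean connectives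
  and division become expressible.\<close>

datatype trm = Var nat | One | Len | Bit trm | Add trm trm | Mul trm trm | Sub trm trm | Sum trm trm

primrec eval :: "bool list \<Rightarrow> (nat \<Rightarrow> nat) \<Rightarrow> trm \<Rightarrow> nat" where
  "eval x \<rho> (Var i) = \<rho> i"
| "eval x \<rho> One = 1"
| "eval x \<rho> Len = length x"
| "eval x \<rho> (Bit a) = of_bool (content_of x (int (eval x \<rho> a)) = 2)"
| "eval x \<rho> (Add a b) = eval x \<rho> a + eval x \<rho> b"
| "eval x \<rho> (Mul a b) = eval x \<rho> a * eval x \<rho> b"
| "eval x \<rho> (Sub a b) = eval x \<rho> a - eval x \<rho> b"
| "eval x \<rho> (Sum a b) = (\<Sum>i<eval x \<rho> a. eval x (case_nat i \<rho>) b)"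

text \<open>
  \<open>comp_trm t reg b d\<close> adds the value of \<open>t\<close> to register \<open>d\<close>. Variable \<open>i\<close> lives in register
  \<open>reg i\<close>, and the registers from \<open>b\<close> on are scratch registers, zero before and after.
\<close>

primrec comp_trm :: "trm \<Rightarrow> (nat \<Rightarrow> nat) \<Rightarrow> nat \<Rightarrow> nat \<Rightarrow> cmd" where
  "comp_trm (Var i) reg b d =
     Seq (While (reg i) (Seq (Dec (reg i)) (Seq (Inc d) (Inc b)))) (While b (Seq (Dec b) (Inc (reg i))))"
| "comp_trm One reg b d = Inc d"
| "comp_trm Len reg b d =
     Seq (Seq (IncIf 1 b) (IncIf 2 b))
    (Seq (While b (Seq (Dec b) (Seq (InMove Right_Move) (Seq (Inc d) (Seq (Inc (Suc b)) (Seq (IncIf 1 b) (IncIf 2 b)))))))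
         (While (Suc b) (Seq (Dec (Suc b)) (InMove Left_Move))))"
| "comp_trm (Bit a) reg b d =
     Seq (comp_trm a reg (b + 2) b)
    (Seq (While b (Seq (Dec b) (Seq (Inc (Suc b)) (InMove Right_Move))))
    (Seq (IncIf 2 d) (While (Suc b) (Seq (Dec (Suc b)) (InMove Left_Move)))))"
| "comp_trm (Add a c) reg b d = Seq (comp_trm a reg b d) (comp_trm c reg b d)"
| "comp_trm (Mul a c) reg b d =
     Seq (comp_trm a reg (Suc b) b) (While b (Seq (Dec b) (comp_trm c reg (Suc b) d)))"
| "comp_trm (Sub a c) reg b d =
     Seq (comp_trm a reg (b + 2) b) (Seq (comp_trm c reg (b + 2) (Suc b))
    (Seq (While (Suc b) (Seq (Dec (Suc b)) (Dec b))) (While b (Seq (Dec b) (Inc d)))))"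
| "comp_trm (Sum a c) reg b d =
     Seq (comp_trm a reg (b + 2) b)
    (Seq (While b (Seq (Dec b) (Seq (comp_trm c (case_nat (Suc b) reg) (b + 2) d) (Inc (Suc b)))))
         (While (Suc b) (Dec (Suc b))))"

abbreviation pX :: "nat poly" where "pX \<equiv> [:0, 1:]"

text \<open>The argument bounds all variables and the input length at once. Below a sum the new
  variable can reach the value of the upper limit, hence the composition with
  \<open>pX + vbound a\<close>; \<open>cost\<close> follows the same pattern.\<close>

primrec vbound :: "trm \<Rightarrow> nat poly" where
  "vbound (Var i) = pX"
| "vbound One = 1"
| "vbound Len = pX"
| "vbound (Bit a) = 1"
| "vbound (Add a b) = vbound a + vbound b"
| "vbound (Mul a b) = vbound a * vbound b"
| "vbound (Sub a b) = vbound a"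
| "vbound (Sum a b) = vbound a * pcompose (vbound b) (pX + vbound a)"

primrec cost :: "trm \<Rightarrow> nat poly" where
  "cost (Var i) = 12 * pX + 10"
| "cost One = 1"
| "cost Len = 20 * pX + 20"
| "cost (Bit a) = cost a + 20 * vbound a + 20"
| "cost (Add a b) = cost a + cost b + 1"
| "cost (Mul a b) = cost a + vbound a * (cost b + 5) + 10"
| "cost (Sub a b) = cost a + cost b + 10 * vbound a + 10 * vbound b + 10"
| "cost (Sum a b) = cost a + vbound a * (pcompose (cost b) (pX + vbound a) + 10) + 10"

lemma poly_nat_mono: "m \<le> n \<Longrightarrow> poly p m \<le> poly (p :: nat poly) n"
  by (induction p) (auto intro!: add_mono mult_mono)

lemma poly_numeral_nat [simp]: "poly (numeral n :: nat poly) m = numeral n"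
  by (metis of_nat_numeral of_nat_poly poly_pCons poly_0 mult_zero_right add.right_neutral of_nat_id)

lemma eval_le_vbound:
  "(\<And>i. \<rho> i \<le> B) \<Longrightarrow> length x \<le> B \<Longrightarrow> eval x \<rho> t \<le> poly (vbound t) B"
proof (induction t arbitrary: \<rho> B)
  case (Sum a c)
  let ?B = "B + poly (vbound a) B"
  have a: "eval x \<rho> a \<le> poly (vbound a) B" using Sum by blast
  have "eval x (case_nat i \<rho>) c \<le> poly (vbound c) ?B" if "i < eval x \<rho> a" for i
    using Sum.prems that a by (intro Sum.IH) (auto split: nat.split simp: trans_le_add1)
  then have "(\<Sum>i<eval x \<rho> a. eval x (case_nat i \<rho>) c) \<le> (\<Sum>i<eval x \<rho> a. poly (vbound c) ?B)"
    by (intro sum_mono) auto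
  also have "\<dots> \<le> poly (vbound a) B * poly (vbound c) ?B" using a by simp
  finally show ?case by (simp add: poly_pcompose)
qed (auto intro: add_mono mult_mono diff_le_self order_trans)

text \<open>Structural induction on the term, with effect and time bound together. The target
  \<open>d\<close> must not hold a variable, since it changes while variables are still being read,
  for instance in the rounds of a product.\<close>

lemma exec_comp_trm:
  assumes "\<And>i. reg i < b" "d < b" "\<And>i. reg i \<noteq> d" "\<And>r. b \<le> r \<Longrightarrow> s r = 0"
    and "\<And>i. s (reg i) \<le> B" "length x \<le> B"
  shows "exec x (comp_trm t reg b d) (0, s, out) (0, s(d := s d + eval x (\<lambda>i. s (reg i)) t), out) (poly (cost t) B)"
  using assms
proof (induction t arbitrary: reg b d s B)
  case (Var i)
  let ?r = "reg i"
  have ne: "?r \<noteq> b" "?r \<noteq> d" "d \<noteq> b" "b \<noteq> ?r" "d \<noteq> ?r" "b \<noteq> d" using Var.prems(1)[of i] Var.prems(2,3) by auto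
  \<comment> \<open>Reading a counter destroys it, so the variable is drained into both
    \<open>d\<close> and the scratch register \<open>b\<close>, and then restored from
    \<open>b\<close>.\<close>
  have "exec x (While ?r (Seq (Dec ?r) (Seq (Inc d) (Inc b)))) (0, s, out)
      ((\<lambda>_. 0) (s ?r), ((\<lambda>j. s(d := s d + j, b := j)) (s ?r))(?r := 0), (\<lambda>_. out) (s ?r)) (s ?r * (3 + 3) + 1)"
    by (rule exec_drain)
      (use ne Var.prems(4)[of b] in \<open>auto intro!: exec_eqI[OF exec_Seq[OF exec_Inc exec_Inc]] simp: fun_eq_iff\<close>)
  note 1 = exec_Seq[OF this exec_move_reg[of b ?r]]
  show ?case
    unfolding comp_trm.simps
    by (rule exec_eqI[OF 1]) (use ne Var.prems(4)[of b] Var.prems(5)[of i] in \<open>auto simp: fun_eq_iff\<close>)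
next
  case One
  then show ?case by (auto intro!: exec_eqI[OF exec_Inc])
next
  case Len
  let ?n = "length x"
  let ?fl = "Seq (IncIf 1 b) (IncIf 2 b)"
  have ne: "d \<noteq> b" "d \<noteq> Suc b" "b \<noteq> d" "Suc b \<noteq> d" using Len.prems(2) by auto
  have fl: "exec x ?fl (p, s', out) (p, s'(b := s' b + of_bool (content_of x p \<noteq> 0)), out) 3" for p s'
    by (rule exec_eqI[OF exec_Seq[OF exec_IncIf exec_IncIf]]) (auto simp: content_of_def fun_eq_iff)
  \<comment> \<open>Register \<open>b\<close> is a flag telling whether the head still scans a bit,
    and \<open>Suc b\<close> records the head position for the rewind.\<close>
  define S where "S j = s(d := s d + j, Suc b := j, b := of_bool (j < ?n))" for j
  have nb: "content_of x (int j) \<noteq> 0 \<longleftrightarrow> j < ?n" for j by (auto simp: content_of_def)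
  have A: "exec x ?fl (0, s, out) (int 0, S 0, out) 3"
    by (rule exec_eqI[OF fl]) (use Len.prems(4)[of b] Len.prems(4)[of "Suc b"] in \<open>auto simp: S_def fun_eq_iff content_of_def\<close>)
  have body: "exec x (Seq (Dec b) (Seq (InMove Right_Move) (Seq (Inc d) (Seq (Inc (Suc b)) ?fl))))
     (int j, S j, out) (int (Suc j), S (Suc j), out) 11" if "j < ?n" for j
    by (rule exec_eqI[OF exec_Seq[OF exec_Dec exec_Seq[OF exec_InMove exec_Seq[OF exec_Inc exec_Seq[OF exec_Inc fl]]]]])
      (use that ne nb[of "Suc j"] in \<open>auto simp: S_def fun_eq_iff add.commute\<close>)
  have B: "exec x (While b (Seq (Dec b) (Seq (InMove Right_Move) (Seq (Inc d) (Seq (Inc (Suc b)) ?fl)))))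
     (int 0, S 0, (\<lambda>_. out) 0) (int ?n, S ?n, (\<lambda>_. out) ?n) (?n * (11 + 1) + 1)"
    by (rule exec_While[where P = int and F = "\<lambda>_. out", OF body]) (auto simp: S_def)
  have C: "exec x (While (Suc b) (Seq (Dec (Suc b)) (InMove Left_Move))) (int ?n, S ?n, out)
     (0, (S ?n)(Suc b := 0), out) (S ?n (Suc b) * 4 + 1)"
    by (rule exec_rewind) (use ne in \<open>simp add: S_def\<close>)
  show ?case unfolding comp_trm.simps
    by (rule exec_eqI[OF exec_Seq[OF A exec_Seq[OF B C]]])
      (use ne Len.prems(4)[of b] Len.prems(4)[of "Suc b"] Len.prems(6) in \<open>auto simp: S_def fun_eq_iff\<close>)
next
  case (Bit a)
  let ?v = "eval x (\<lambda>i. s (reg i)) a"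
  have ne: "d \<noteq> b" "d \<noteq> Suc b" "b \<noteq> d" "Suc b \<noteq> d" "s b = 0" "s (Suc b) = 0" using Bit.prems by auto
  have regne: "reg i \<noteq> b" "reg i < Suc (Suc b)" for i using Bit.prems(1)[of i] by simp_all
  have v: "?v \<le> poly (vbound a) B" by (intro eval_le_vbound Bit.prems)
  have A: "exec x (comp_trm a reg (b + 2) b) (0, s, out) (0, s(b := ?v), out) (poly (cost a) B)"
    by (rule exec_eqI[OF Bit.IH[of reg "b + 2" b s B]]) (use Bit.prems ne regne in \<open>auto\<close>)
  have B: "exec x (While b (Seq (Dec b) (Seq (Inc (Suc b)) (InMove Right_Move)))) (0, s(b := ?v), out)
      (int ?v, ((\<lambda>j. s(Suc b := j)) ?v)(b := 0), (\<lambda>_. out) ?v) (?v * (3 + 3) + 1)"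
    by (rule exec_drain) (use ne in \<open>auto intro!: exec_eqI[OF exec_Seq[OF exec_Inc exec_InMove]] simp: fun_eq_iff\<close>)
  show ?case unfolding comp_trm.simps
    by (rule exec_eqI[OF exec_Seq[OF A exec_Seq[OF B exec_Seq[OF exec_IncIf exec_rewind]]]])
      (use ne v in \<open>auto simp: fun_eq_iff\<close>)
next
  case (Add a c)
  have A: "exec x (comp_trm a reg b d) (0, s, out) (0, s(d := s d + eval x (\<lambda>i. s (reg i)) a), out) (poly (cost a) B)"
    by (rule Add.IH) (use Add.prems in auto)
  have C: "exec x (comp_trm c reg b d) (0, s(d := s d + eval x (\<lambda>i. s (reg i)) a), out)
     (0, s(d := s d + eval x (\<lambda>i. s (reg i)) a + eval x (\<lambda>i. s (reg i)) c), out) (poly (cost c) B)"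
    by (rule exec_eqI[OF Add.IH(2)[of reg b d "s(d := s d + eval x (\<lambda>i. s (reg i)) a)" B]]) (use Add.prems in auto)
  show ?case unfolding comp_trm.simps
    by (rule exec_eqI[OF exec_Seq[OF A C]]) auto
next
  case (Mul a c)
  let ?v = "eval x (\<lambda>i. s (reg i)) a" and ?w = "eval x (\<lambda>i. s (reg i)) c"
  have ne: "d \<noteq> b" "b \<noteq> d" "s b = 0" using Mul.prems by auto
  have regne: "reg i \<noteq> b" "reg i < Suc b" for i using Mul.prems(1)[of i] by simp_all
  have v: "?v \<le> poly (vbound a) B" by (intro eval_le_vbound Mul.prems)
  have A: "exec x (comp_trm a reg (Suc b) b) (0, s, out) (0, s(b := ?v), out) (poly (cost a) B)"
    by (rule exec_eqI[OF Mul.IH(1)[of reg "Suc b" b s B]]) (use Mul.prems ne regne in \<open>auto\<close>)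
  have B: "exec x (While b (Seq (Dec b) (comp_trm c reg (Suc b) d))) (0, s(b := ?v), out)
      ((\<lambda>_. 0) ?v, ((\<lambda>j. s(d := s d + j * ?w)) ?v)(b := 0), (\<lambda>_. out) ?v) (?v * (poly (cost c) B + 3) + 1)"
  proof (rule exec_drain)
    fix j assume "j < ?v"
    let ?s = "s(d := s d + j * ?w, b := ?v - Suc j)"
    show "exec x (comp_trm c reg (Suc b) d) (0, ?s, out) (0, s(d := s d + Suc j * ?w, b := ?v - Suc j), out) (poly (cost c) B)"
      by (rule exec_eqI[OF Mul.IH(2)[of reg "Suc b" d ?s B]]) (use Mul.prems ne regne in \<open>auto simp: fun_eq_iff\<close>)
  qed (use ne in auto)
  have le: "?v * (poly (cost c) B + 3) \<le> poly (vbound a) B * (poly (cost c) B + 5)"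
    using v by (intro mult_mono) auto
  show ?case unfolding comp_trm.simps
    by (rule exec_eqI[OF exec_Seq[OF A B]]) (use ne le in \<open>auto simp: fun_eq_iff\<close>)
next
  case (Sub a c)
  let ?v = "eval x (\<lambda>i. s (reg i)) a" and ?w = "eval x (\<lambda>i. s (reg i)) c"
  have ne: "d \<noteq> b" "b \<noteq> d" "d \<noteq> Suc b" "Suc b \<noteq> d" "s b = 0" "s (Suc b) = 0" using Sub.prems by auto
  have regne: "reg i \<noteq> b" "reg i \<noteq> Suc b" "reg i < Suc (Suc b)" for i using Sub.prems(1)[of i] by simp_all
  have v: "?v \<le> poly (vbound a) B" "?w \<le> poly (vbound c) B" by (intro eval_le_vbound Sub.prems)+
  have A: "exec x (comp_trm a reg (b + 2) b) (0, s, out) (0, s(b := ?v), out) (poly (cost a) B)"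
    by (rule exec_eqI[OF Sub.IH(1)[of reg "b + 2" b s B]]) (use Sub.prems ne regne in \<open>auto\<close>)
  have C: "exec x (comp_trm c reg (b + 2) (Suc b)) (0, s(b := ?v), out) (0, s(b := ?v, Suc b := ?w), out) (poly (cost c) B)"
    by (rule exec_eqI[OF Sub.IH(2)[of reg "b + 2" "Suc b" "s(b := ?v)" B]])
      (use Sub.prems ne regne in \<open>auto\<close>)
  have D: "exec x (While (Suc b) (Seq (Dec (Suc b)) (Dec b))) (0, s(b := ?v, Suc b := ?w), out)
      ((\<lambda>_. 0) ?w, ((\<lambda>j. s(b := ?v - j)) ?w)(Suc b := 0), (\<lambda>_. out) ?w) (?w * (1 + 3) + 1)"
    by (rule exec_drain) (use ne in \<open>auto intro!: exec_eqI[OF exec_Dec] simp: fun_eq_iff\<close>)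
  have le: "?v - ?w \<le> poly (vbound a) B" using v by linarith
  show ?case unfolding comp_trm.simps
    by (rule exec_eqI[OF exec_Seq[OF A exec_Seq[OF C exec_Seq[OF D exec_move_reg]]]])
      (use ne v le in \<open>auto simp: fun_eq_iff\<close>)
next
  case (Sum a c)
  let ?\<rho> = "\<lambda>i. s (reg i)"
  let ?v = "eval x ?\<rho> a"
  let ?B = "B + poly (vbound a) B"
  let ?w = "\<lambda>j. eval x (case_nat j ?\<rho>) c"
  have ne: "d \<noteq> b" "b \<noteq> d" "d \<noteq> Suc b" "Suc b \<noteq> d" "s b = 0" "s (Suc b) = 0" using Sum.prems by auto
  have regne: "reg i \<noteq> b" "reg i \<noteq> Suc b" "reg i < Suc (Suc b)" for i using Sum.prems(1)[of i] by simp_all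
  have v: "?v \<le> poly (vbound a) B" by (intro eval_le_vbound Sum.prems)
  have A: "exec x (comp_trm a reg (b + 2) b) (0, s, out) (0, s(b := ?v), out) (poly (cost a) B)"
    by (rule exec_eqI[OF Sum.IH(1)[of reg "b + 2" b s B]]) (use Sum.prems ne regne in \<open>auto\<close>)
  have B: "exec x (While b (Seq (Dec b) (Seq (comp_trm c (case_nat (Suc b) reg) (b + 2) d) (Inc (Suc b))))) (0, s(b := ?v), out)
      ((\<lambda>_. 0) ?v, ((\<lambda>j. s(d := s d + (\<Sum>i<j. ?w i), Suc b := j)) ?v)(b := 0), (\<lambda>_. out) ?v)
      (?v * (poly (cost c) ?B + 2 + 3) + 1)"
  proof (rule exec_drain)
    fix j assume j: "j < ?v"
    let ?s = "s(d := s d + (\<Sum>i<j. ?w i), Suc b := j, b := ?v - Suc j)"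
    \<comment> \<open>The round counter \<open>Suc b\<close> doubles as the bound variable, so
      extending the register assignment by it extends the environment by \<open>j\<close>.\<close>
    have e: "(\<lambda>i. ?s (case_nat (Suc b) reg i)) = case_nat j ?\<rho>"
      using ne regne Sum.prems(3) by (auto simp: fun_eq_iff split: nat.split)
    have "exec x (comp_trm c (case_nat (Suc b) reg) (b + 2) d) (0, ?s, out)
       (0, ?s(d := ?s d + eval x (\<lambda>i. ?s (case_nat (Suc b) reg i)) c), out) (poly (cost c) ?B)"
    proof (rule Sum.IH(2))
      show "?s (case_nat (Suc b) reg i) \<le> ?B" for i
        using fun_cong[OF e, of i] j v Sum.prems(5) by (auto split: nat.split simp: trans_le_add1)
    qed (use Sum.prems ne regne in \<open>auto split: nat.split\<close>)
    note this[unfolded e]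
    from exec_Seq[OF this exec_Inc[of _ "Suc b"]]
    show "exec x (Seq (comp_trm c (case_nat (Suc b) reg) (b + 2) d) (Inc (Suc b))) (0, ?s, out)
       (0, s(d := s d + (\<Sum>i<Suc j. ?w i), Suc b := Suc j, b := ?v - Suc j), out) (poly (cost c) ?B + 2)"
      by (rule exec_eqI) (use ne in \<open>auto simp: fun_eq_iff\<close>)
  qed (use ne in auto)
  have le: "?v * (poly (cost c) ?B + 2 + 3) + ?v * 2 \<le> poly (vbound a) B * (poly (cost c) ?B + 10)"
    using mult_mono[OF v, of "poly (cost c) ?B + 7" "poly (cost c) ?B + 10"] by (simp add: algebra_simps)
  show ?case unfolding comp_trm.simps
    by (rule exec_eqI[OF exec_Seq[OF A exec_Seq[OF B exec_clear]]])
      (use ne le in \<open>auto simp: fun_eq_iff poly_pcompose\<close>)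
qed


section \<open>Programs that write binary numbers and matrices\<close>

subsection \<open>Output programs\<close>

text \<open>The quotient counts the positive multiples of \<open>b\<close> up to \<open>a\<close>,
  which turns division into a bounded sum of comparisons.\<close>

lemma sum_of_bool_div:
  assumes b: "0 < b"
  shows "(\<Sum>i<a. of_bool (Suc i * b \<le> a)) = (a div b :: nat)"
proof -
  have iff: "Suc i * b \<le> a \<longleftrightarrow> i < a div b" for i
    using less_eq_div_iff_mult_less_eq[OF b, of "Suc i" a] by (simp add: Suc_le_eq)
  have "{..<a} \<inter> {i. i < a div b} = {..<a div b}"
    using div_le_dividend[of a b] by (auto simp del: div_le_dividend)
  then show ?thesis unfolding iff by simp
qed

text \<open>\<open>Sub One (Sub u v)\<close> is the indicator of \<open>u \<le> v\<close>. Inside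
  the sum \<open>Var 0\<close> is the summation index and \<open>Var 1\<close> the number to be
  halved.\<close>

definition half_trm :: trm where
  "half_trm = Sum (Var 0) (Sub One (Sub (Add (Add (Var 0) (Var 0)) (Add One One)) (Var 1)))"

definition parity_trm :: trm where
  "parity_trm = Sub (Var 0) (Add half_trm half_trm)"

lemma eval_half_trm: "eval x \<rho> half_trm = \<rho> 0 div 2"
proof -
  have "eval x \<rho> half_trm = (\<Sum>i<\<rho> 0. of_bool (Suc i * 2 \<le> \<rho> 0))"
    unfolding half_trm_def by (simp del: sum_of_bool_eq, rule sum.cong) auto
  then show ?thesis using sum_of_bool_div[of 2 "\<rho> 0"] by (simp del: sum_of_bool_eq)
qed

lemma eval_parity_trm: "eval x \<rho> parity_trm = \<rho> 0 mod 2"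
  by (simp add: parity_trm_def eval_half_trm minus_mult_div_eq_mod[symmetric])

text \<open>One round emits the marker \<open>True\<close> and the lowest bit, in the format of a
  first component of \<open>pair_code\<close>, and halves the register.\<close>

definition nat_body :: "nat \<Rightarrow> cmd" where
  "nat_body b = Seq (Seq (Inc (Suc b)) (Seq (OutBit (Suc b)) (Dec (Suc b))))
    (Seq (Seq (comp_trm parity_trm (\<lambda>_. b) (b + 2) (Suc b)) (Seq (OutBit (Suc b)) (While (Suc b) (Dec (Suc b)))))
    (Seq (comp_trm half_trm (\<lambda>_. b) (b + 2) (Suc b))
    (Seq (While b (Dec b)) (While (Suc b) (Seq (Dec (Suc b)) (Inc b))))))"

definition nat_cost :: "nat poly" where
  "nat_cost = cost parity_trm + cost half_trm + 6 * pX + 40"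

lemma exec_nat_body:
  assumes "\<And>r. b < r \<Longrightarrow> s r = 0" "s b \<le> B" "length x \<le> B"
  shows "exec x (nat_body b) (0, s, out) (0, s(b := s b div 2), out @ [True, odd (s b)]) (poly nat_cost B)"
proof -
  have z: "s (Suc b) = 0" using assms(1) by simp
  have A: "exec x (Seq (Inc (Suc b)) (Seq (OutBit (Suc b)) (Dec (Suc b)))) (0, s, out) (0, s, out @ [True]) 5"
    by (rule exec_eqI[OF exec_Seq[OF exec_Inc exec_Seq[OF exec_OutBit exec_Dec]]]) (use z in \<open>auto simp: fun_eq_iff\<close>)
  have B: "exec x (comp_trm parity_trm (\<lambda>_. b) (b + 2) (Suc b)) (0, s, out @ [True])
      (0, s(Suc b := s b mod 2), out @ [True]) (poly (cost parity_trm) B)"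
    by (rule exec_eqI[OF exec_comp_trm[where B = B]]) (use assms z in \<open>auto simp: eval_parity_trm\<close>)
  have B': "exec x (Seq (comp_trm parity_trm (\<lambda>_. b) (b + 2) (Suc b)) (Seq (OutBit (Suc b)) (While (Suc b) (Dec (Suc b)))))
     (0, s, out @ [True]) (0, s, out @ [True, odd (s b)]) (poly (cost parity_trm) B + 6)"
    by (rule exec_eqI[OF exec_Seq[OF B exec_Seq[OF exec_OutBit exec_clear]]])
      (use z in \<open>auto simp: fun_eq_iff mod2_eq_if\<close>)
  have C: "exec x (comp_trm half_trm (\<lambda>_. b) (b + 2) (Suc b)) (0, s, out @ [True, odd (s b)])
      (0, s(Suc b := s b div 2), out @ [True, odd (s b)]) (poly (cost half_trm) B)"
    by (rule exec_eqI[OF exec_comp_trm[where B = B]]) (use assms z in \<open>auto simp: eval_half_trm\<close>)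
  have le: "s b \<le> B" "s b div 2 \<le> B" using assms(2) by auto
  show ?thesis unfolding nat_body_def
    by (rule exec_eqI[OF exec_Seq[OF A exec_Seq[OF B' exec_Seq[OF C exec_Seq[OF exec_clear exec_move_reg]]]]])
      (use z le in \<open>auto simp: fun_eq_iff nat_cost_def\<close>)
qed

abbreviation prefixed :: "bool list \<Rightarrow> bool list" where
  "prefixed xs \<equiv> concat (map (\<lambda>b. [True, b]) xs)"

text \<open>The number of rounds is bounded crudely by the value itself, as halving a positive
  number lowers it by at least one. This is good enough because all values are polynomially
  bounded.\<close>

lemma exec_nat_loop:
  assumes "\<And>r. b < r \<Longrightarrow> s r = 0" "s b \<le> B" "length x \<le> B"
  shows "exec x (While b (nat_body b)) (0, s, out) (0, s(b := 0), out @ prefixed (nat_code (s b)))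
     (s b * (poly nat_cost B + 1) + 1)"
  using assms
proof (induction "s b" arbitrary: s out rule: less_induct)
  case less
  show ?case
  proof (cases "s b = 0")
    case True
    then show ?thesis by (intro exec_eqI[OF exec_While_zero]) (auto simp: nat_code.simps)
  next
    case False
    let ?s = "s(b := s b div 2)"
    have "exec x (While b (nat_body b)) (0, ?s, out @ [True, odd (s b)])
       (0, ?s(b := 0), (out @ [True, odd (s b)]) @ prefixed (nat_code (?s b))) (?s b * (poly nat_cost B + 1) + 1)"
      by (rule less.hyps) (use less.prems False in auto)
    note rest = this
    have "exec x (nat_body b) (0, s, out) (0, ?s, out @ [True, odd (s b)]) (poly nat_cost B)"
      by (rule exec_nat_body) (use less.prems in auto)
    from exec_While_step[OF False this rest]
    show ?thesis
    proof (rule exec_eqI)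
      show "(0, ?s(b := 0), (out @ [True, odd (s b)]) @ prefixed (nat_code (?s b))) =
        (0, s(b := 0), out @ prefixed (nat_code (s b)))"
        using False by (subst (2) nat_code.simps) simp
      have "(s b div 2 + 1) * (poly nat_cost B + 1) \<le> s b * (poly nat_cost B + 1)"
        by (rule mult_right_mono) (use False in linarith, simp)
      then show "poly nat_cost B + (?s b * (poly nat_cost B + 1) + 1) + 1 \<le> s b * (poly nat_cost B + 1) + 1"
        by simp
    qed
  qed
qed

text \<open>\<open>ONat\<close> omits the separator \<open>False\<close> of
  \<open>pair_code\<close>, which is written by a separate \<open>OBit\<close>. \<open>OFor\<close>
  binds index \<open>0\<close>, as \<open>Sum\<close> does.\<close>

datatype outp = OBit trm | ONat trm | OApp outp outp | OFor trm outp

primrec oeval :: "bool list \<Rightarrow> (nat \<Rightarrow> nat) \<Rightarrow> outp \<Rightarrow> bool list" where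
  "oeval x \<rho> (OBit t) = [eval x \<rho> t \<noteq> 0]"
| "oeval x \<rho> (ONat t) = prefixed (nat_code (eval x \<rho> t))"
| "oeval x \<rho> (OApp a b) = oeval x \<rho> a @ oeval x \<rho> b"
| "oeval x \<rho> (OFor t a) = concat (map (\<lambda>i. oeval x (case_nat i \<rho>) a) [0..<eval x \<rho> t])"

primrec comp_out :: "outp \<Rightarrow> (nat \<Rightarrow> nat) \<Rightarrow> nat \<Rightarrow> cmd" where
  "comp_out (OBit t) reg b = Seq (comp_trm t reg (Suc b) b) (Seq (OutBit b) (While b (Dec b)))"
| "comp_out (ONat t) reg b = Seq (comp_trm t reg (Suc b) b) (While b (nat_body b))"
| "comp_out (OApp o1 o2) reg b = Seq (comp_out o1 reg b) (comp_out o2 reg b)"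
| "comp_out (OFor t o1) reg b = Seq (comp_trm t reg (b + 2) b)
    (Seq (While b (Seq (Dec b) (Seq (comp_out o1 (case_nat (Suc b) reg) (b + 2)) (Inc (Suc b)))))
         (While (Suc b) (Dec (Suc b))))"

primrec ocost :: "outp \<Rightarrow> nat poly" where
  "ocost (OBit t) = cost t + 2 * vbound t + 10"
| "ocost (ONat t) = cost t + vbound t * (pcompose nat_cost (pX + vbound t) + 1) + 10"
| "ocost (OApp o1 o2) = ocost o1 + ocost o2 + 1"
| "ocost (OFor t o1) = cost t + vbound t * (pcompose (ocost o1) (pX + vbound t) + 10) + 10"

lemma exec_comp_out:
  assumes "\<And>i. reg i < b" "\<And>r. b \<le> r \<Longrightarrow> s r = 0" "\<And>i. s (reg i) \<le> B" "length x \<le> B"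
  shows "exec x (comp_out a reg b) (0, s, out) (0, s, out @ oeval x (\<lambda>i. s (reg i)) a) (poly (ocost a) B)"
  using assms
proof (induction a arbitrary: reg b s B out)
  case (OBit t)
  let ?v = "eval x (\<lambda>i. s (reg i)) t"
  have regne: "reg i \<noteq> b" "reg i < Suc b" for i using OBit.prems(1)[of i] by simp_all
  have z: "s b = 0" using OBit.prems by simp
  have v: "?v \<le> poly (vbound t) B" by (intro eval_le_vbound OBit.prems)
  have A: "exec x (comp_trm t reg (Suc b) b) (0, s, out) (0, s(b := ?v), out) (poly (cost t) B)"
    by (rule exec_eqI[OF exec_comp_trm[where B = B]]) (use OBit.prems z regne in auto)
  show ?case unfolding comp_out.simps
    by (rule exec_eqI[OF exec_Seq[OF A exec_Seq[OF exec_OutBit exec_clear]]]) (use v z in \<open>auto simp: fun_eq_iff\<close>)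
next
  case (ONat t)
  let ?v = "eval x (\<lambda>i. s (reg i)) t"
  let ?B = "B + poly (vbound t) B"
  have regne: "reg i \<noteq> b" "reg i < Suc b" for i using ONat.prems(1)[of i] by simp_all
  have z: "s b = 0" using ONat.prems by simp
  have v: "?v \<le> poly (vbound t) B" by (intro eval_le_vbound ONat.prems)
  have A: "exec x (comp_trm t reg (Suc b) b) (0, s, out) (0, s(b := ?v), out) (poly (cost t) B)"
    by (rule exec_eqI[OF exec_comp_trm[where B = B]]) (use ONat.prems z regne in auto)
  have le: "?v * (poly nat_cost ?B + 1) \<le> poly (vbound t) B * (poly nat_cost ?B + 1)"
    using v by (intro mult_right_mono) auto
  show ?case unfolding comp_out.simps
    by (rule exec_eqI[OF exec_Seq[OF A exec_nat_loop[where B = ?B]]])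
      (use v z le ONat.prems in \<open>auto simp: fun_eq_iff poly_pcompose\<close>)
next
  case (OApp o1 o2)
  have "exec x (comp_out o1 reg b) (0, s, out) (0, s, out @ oeval x (\<lambda>i. s (reg i)) o1) (poly (ocost o1) B)"
    by (rule OApp.IH) (use OApp.prems in auto)
  moreover have "exec x (comp_out o2 reg b) (0, s, out @ oeval x (\<lambda>i. s (reg i)) o1)
     (0, s, (out @ oeval x (\<lambda>i. s (reg i)) o1) @ oeval x (\<lambda>i. s (reg i)) o2) (poly (ocost o2) B)"
    by (rule OApp.IH) (use OApp.prems in auto)
  ultimately show ?case unfolding comp_out.simps by (rule exec_eqI[OF exec_Seq]) auto
next
  case (OFor t a)
  let ?\<rho> = "\<lambda>i. s (reg i)"
  let ?v = "eval x ?\<rho> t"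
  let ?B = "B + poly (vbound t) B"
  let ?w = "\<lambda>j. concat (map (\<lambda>i. oeval x (case_nat i ?\<rho>) a) [0..<j])"
  have z: "s b = 0" "s (Suc b) = 0" using OFor.prems by auto
  have regne: "reg i \<noteq> b" "reg i \<noteq> Suc b" "reg i < Suc (Suc b)" for i using OFor.prems(1)[of i] by simp_all
  have v: "?v \<le> poly (vbound t) B" by (intro eval_le_vbound OFor.prems)
  have A: "exec x (comp_trm t reg (b + 2) b) (0, s, out) (0, s(b := ?v), out) (poly (cost t) B)"
    by (rule exec_eqI[OF exec_comp_trm[where B = B]]) (use OFor.prems z regne in auto)
  have B: "exec x (While b (Seq (Dec b) (Seq (comp_out a (case_nat (Suc b) reg) (b + 2)) (Inc (Suc b))))) (0, s(b := ?v), out)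
      ((\<lambda>_. 0) ?v, ((\<lambda>j. s(Suc b := j)) ?v)(b := 0), (\<lambda>j. out @ ?w j) ?v)
      (?v * (poly (ocost a) ?B + 2 + 3) + 1)"
  proof (rule exec_drain)
    fix j assume j: "j < ?v"
    let ?s = "s(Suc b := j, b := ?v - Suc j)"
    have e: "(\<lambda>i. ?s (case_nat (Suc b) reg i)) = case_nat j ?\<rho>"
      using regne by (auto simp: fun_eq_iff split: nat.split)
    have "exec x (comp_out a (case_nat (Suc b) reg) (b + 2)) (0, ?s, out @ ?w j)
       (0, ?s, (out @ ?w j) @ oeval x (\<lambda>i. ?s (case_nat (Suc b) reg i)) a) (poly (ocost a) ?B)"
    proof (rule OFor.IH)
      show "?s (case_nat (Suc b) reg i) \<le> ?B" for i
        using fun_cong[OF e, of i] j v OFor.prems(3) by (auto split: nat.split simp: trans_le_add1)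
    qed (use OFor.prems regne in \<open>auto split: nat.split\<close>)
    note this[unfolded e]
    from exec_Seq[OF this exec_Inc[of _ "Suc b"]]
    show "exec x (Seq (comp_out a (case_nat (Suc b) reg) (b + 2)) (Inc (Suc b))) (0, ?s, out @ ?w j)
       (0, s(Suc b := Suc j, b := ?v - Suc j), out @ ?w (Suc j)) (poly (ocost a) ?B + 2)"
      by (rule exec_eqI) (auto simp: fun_eq_iff)
  qed (use z in auto)
  have le: "?v * (poly (ocost a) ?B + 2 + 3) + ?v * 2 \<le> poly (vbound t) B * (poly (ocost a) ?B + 10)"
    using mult_mono[OF v, of "poly (ocost a) ?B + 7" "poly (ocost a) ?B + 10"] by (simp add: algebra_simps)
  show ?case unfolding comp_out.simps
    by (rule exec_eqI[OF exec_Seq[OF A exec_Seq[OF B exec_clear]]])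
      (use z le in \<open>auto simp: fun_eq_iff poly_pcompose\<close>)
qed

text \<open>All variables share register \<open>0\<close>, which is zero, so the input length alone
  bounds everything that enters the cost.\<close>

lemma polytime_oeval: "polytime (\<lambda>x. oeval x (\<lambda>_. 0) a)"
proof (rule polytime_counter[of "comp_out a (\<lambda>_. 0) 1" _ "ocost a"])
  show "\<exists>p s. exec x (comp_out a (\<lambda>_. 0) 1) (0, \<lambda>_. 0, []) (p, s, oeval x (\<lambda>_. 0) a) (poly (ocost a) (length x))" for x
    using exec_comp_out[of "\<lambda>_. 0" 1 "\<lambda>_. 0" "length x" x a "[]"] by auto
qed

section \<open>Closure properties of term-definable functions and predicates\<close>

subsection \<open>Functions definable by terms\<close>

text \<open>A semantic notion, so that definability of a HOL expression follows from closure rules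
  collected in \<open>pt_intros\<close> and no term has to be written down.\<close>

definition PT :: "(bool list \<Rightarrow> (nat \<Rightarrow> nat) \<Rightarrow> nat) \<Rightarrow> bool" where
  "PT g \<longleftrightarrow> (\<exists>t. \<forall>x \<rho>. g x \<rho> = eval x \<rho> t)"

definition PB :: "(bool list \<Rightarrow> (nat \<Rightarrow> nat) \<Rightarrow> bool) \<Rightarrow> bool" where
  "PB \<phi> \<longleftrightarrow> PT (\<lambda>x \<rho>. of_bool (\<phi> x \<rho>))"

lemma PT_cong: "PT f \<Longrightarrow> (\<And>x \<rho>. g x \<rho> = f x \<rho>) \<Longrightarrow> PT g"
  unfolding PT_def by simp

lemma PB_cong: "PB f \<Longrightarrow> (\<And>x \<rho>. g x \<rho> = f x \<rho>) \<Longrightarrow> PB g"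
  unfolding PB_def PT_def by simp

primrec rename :: "(nat \<Rightarrow> nat) \<Rightarrow> trm \<Rightarrow> trm" where
  "rename \<sigma> (Var i) = Var (\<sigma> i)"
| "rename \<sigma> One = One"
| "rename \<sigma> Len = Len"
| "rename \<sigma> (Bit a) = Bit (rename \<sigma> a)"
| "rename \<sigma> (Add a b) = Add (rename \<sigma> a) (rename \<sigma> b)"
| "rename \<sigma> (Mul a b) = Mul (rename \<sigma> a) (rename \<sigma> b)"
| "rename \<sigma> (Sub a b) = Sub (rename \<sigma> a) (rename \<sigma> b)"
| "rename \<sigma> (Sum a b) = Sum (rename \<sigma> a) (rename (case_nat 0 (\<lambda>i. Suc (\<sigma> i))) b)"

lemma eval_rename: "eval x \<rho> (rename \<sigma> t) = eval x (\<lambda>i. \<rho> (\<sigma> i)) t"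
proof (induction t arbitrary: \<rho> \<sigma>)
  case (Sum a b)
  have "(\<lambda>j. case_nat i \<rho> (case_nat 0 (\<lambda>i. Suc (\<sigma> i)) j)) = case_nat i (\<lambda>i. \<rho> (\<sigma> i))" for i
    by (auto simp: fun_eq_iff split: nat.split)
  then show ?case using Sum by simp
qed auto

text \<open>Serves as weakening: below a binder the outer variables are shifted by one.\<close>

lemma PT_rename: "PT g \<Longrightarrow> PT (\<lambda>x \<rho>. g x (\<lambda>i. \<rho> (\<sigma> i)))"
  unfolding PT_def using eval_rename by metis

named_theorems pt_intros

lemma PT_var [pt_intros]: "PT (\<lambda>x \<rho>. \<rho> i)"
  unfolding PT_def by (intro exI[of _ "Var i"]) simp

lemma PT_length [pt_intros]: "PT (\<lambda>x \<rho>. length x)"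
  unfolding PT_def by (intro exI[of _ Len]) simp

lemma PT_add [pt_intros]: "PT a \<Longrightarrow> PT b \<Longrightarrow> PT (\<lambda>x \<rho>. a x \<rho> + b x \<rho>)"
  unfolding PT_def by (metis eval.simps(5))

lemma PT_mult [pt_intros]: "PT a \<Longrightarrow> PT b \<Longrightarrow> PT (\<lambda>x \<rho>. a x \<rho> * b x \<rho>)"
  unfolding PT_def by (metis eval.simps(6))

lemma PT_diff [pt_intros]: "PT a \<Longrightarrow> PT b \<Longrightarrow> PT (\<lambda>x \<rho>. a x \<rho> - b x \<rho>)"
  unfolding PT_def by (metis eval.simps(7))

lemma PT_const [pt_intros]: "PT (\<lambda>x \<rho>. c)"
proof (induction c)
  case 0
  show ?case unfolding PT_def by (intro exI[of _ "Sub One One"]) simp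
next
  case (Suc c)
  have "PT (\<lambda>x \<rho>. 1)" unfolding PT_def by (intro exI[of _ One]) simp
  from PT_add[OF Suc this] show ?case by simp
qed

lemma PT_Suc [pt_intros]: "PT a \<Longrightarrow> PT (\<lambda>x \<rho>. Suc (a x \<rho>))"
  using PT_add[OF _ PT_const[of 1]] by simp

text \<open>The second premise is the body in de Bruijn form, with the summation index as variable
  \<open>0\<close> and the outer environment shifted.\<close>

lemma PT_sum:
  assumes "PT a" "PT (\<lambda>x \<rho>. f x (\<rho> 0) (\<lambda>i. \<rho> (Suc i)))"
  shows "PT (\<lambda>x \<rho>. \<Sum>i<a x \<rho>. f x i \<rho>)"
proof -
  obtain s t where "\<And>x \<rho>. a x \<rho> = eval x \<rho> s" "\<And>x \<rho>. f x (\<rho> 0) (\<lambda>i. \<rho> (Suc i)) = eval x \<rho> t"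
    using assms unfolding PT_def by auto
  from this(1) this(2)[of _ "case_nat _ _"] show ?thesis
    unfolding PT_def by (intro exI[of _ "Sum s t"]) simp
qed

lemma PB_bit [pt_intros]: "PT a \<Longrightarrow> PB (\<lambda>x \<rho>. content_of x (int (a x \<rho>)) = 2)"
  unfolding PT_def PB_def by (metis eval.simps(4))

text \<open>The indicator is \<open>1 - (a - b)\<close> in truncated subtraction.\<close>

lemma PB_le [pt_intros]:
  assumes a: "PT a" and b: "PT b"
  shows "PB (\<lambda>x \<rho>. a x \<rho> \<le> b x \<rho>)"
  unfolding PB_def by (rule PT_cong[OF PT_diff[OF PT_const[of 1] PT_diff[OF a b]]]) auto

lemma PB_less [pt_intros]:
  assumes a: "PT a" and b: "PT b"
  shows "PB (\<lambda>x \<rho>. a x \<rho> < b x \<rho>)"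
  using PB_le[OF PT_Suc[OF a] b] by (simp add: Suc_le_eq)

lemma PB_not [pt_intros]:
  assumes p: "PB \<phi>"
  shows "PB (\<lambda>x \<rho>. \<not> \<phi> x \<rho>)"
  unfolding PB_def by (rule PT_cong[OF PT_diff[OF PT_const[of 1] p[unfolded PB_def]]]) auto

lemma PB_conj [pt_intros]:
  assumes p: "PB \<phi>" and q: "PB \<psi>"
  shows "PB (\<lambda>x \<rho>. \<phi> x \<rho> \<and> \<psi> x \<rho>)"
  unfolding PB_def by (rule PT_cong[OF PT_mult[OF p[unfolded PB_def] q[unfolded PB_def]]]) auto

lemma PB_disj [pt_intros]:
  assumes p: "PB \<phi>" and q: "PB \<psi>"
  shows "PB (\<lambda>x \<rho>. \<phi> x \<rho> \<or> \<psi> x \<rho>)"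
  by (rule PB_cong[OF PB_not[OF PB_conj[OF PB_not[OF p] PB_not[OF q]]]]) auto

lemma PB_eq [pt_intros]:
  assumes a: "PT a" and b: "PT b"
  shows "PB (\<lambda>x \<rho>. a x \<rho> = b x \<rho>)"
  by (rule PB_cong[OF PB_conj[OF PB_le[OF a b] PB_le[OF b a]]]) auto

lemma PT_div [pt_intros]:
  assumes a: "PT a" and b: "PT b"
  shows "PT (\<lambda>x \<rho>. a x \<rho> div b x \<rho>)"
proof -
  have "PB (\<lambda>x \<rho>. Suc (\<rho> 0) * b x (\<lambda>i. \<rho> (Suc i)) \<le> a x (\<lambda>i. \<rho> (Suc i)))"
    by (intro pt_intros PT_rename[OF a] PT_rename[OF b])
  then have 1: "PT (\<lambda>x \<rho>. \<Sum>i<a x \<rho>. of_bool (Suc i * b x \<rho> \<le> a x \<rho>))"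
    by (intro PT_sum a) (simp add: PB_def)
  \<comment> \<open>For divisor \<open>0\<close> the sum would count all \<open>a\<close> summands;
    this factor restores the convention that division by zero gives zero.\<close>
  have "PB (\<lambda>x \<rho>. 0 < b x \<rho>)"
    by (intro pt_intros b)
  note 2 = PT_mult[OF this[unfolded PB_def] 1]
  show ?thesis
    by (rule PT_cong[OF 2]) (use sum_of_bool_div in \<open>auto simp del: mult_Suc\<close>)
qed

lemma PT_mod [pt_intros]:
  assumes a: "PT a" and b: "PT b"
  shows "PT (\<lambda>x \<rho>. a x \<rho> mod b x \<rho>)"
  by (rule PT_cong[OF PT_diff[OF a PT_mult[OF b PT_div[OF a b]]]]) (auto simp: minus_mult_div_eq_mod)

lemma PB_even [pt_intros]:
  assumes a: "PT a"
  shows "PB (\<lambda>x \<rho>. even (a x \<rho>))"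
  by (rule PB_cong[OF PB_eq[OF PT_mod[OF a PT_const[of 2]] PT_const[of 0]]]) auto

lemma PT_poly [pt_intros]: "PT a \<Longrightarrow> PT (\<lambda>x \<rho>. poly p (a x \<rho>))"
  by (induction p) (auto intro!: pt_intros)

lemma PT_sum_const: "(\<And>i. PT (f i)) \<Longrightarrow> PT (\<lambda>x \<rho>. \<Sum>i<(n::nat). f i x \<rho>)"
  by (induction n) (auto intro!: pt_intros)

text \<open>An arbitrary \<open>Q\<close> is definable on a finite range, by summing over its table
  with constants. In this way the transition function of a fixed machine gets into a term.\<close>

lemma PB_table:
  assumes "PT a" "PT b"
  shows "PB (\<lambda>x \<rho>. a x \<rho> < A \<and> b x \<rho> < A' \<and> Q (a x \<rho>) (b x \<rho>))"
proof -
  have "PT (\<lambda>x \<rho>. \<Sum>i<A. \<Sum>j<A'. of_bool (a x \<rho> = i \<and> b x \<rho> = j) * of_bool (Q i j))"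
    using assms by (intro PT_sum_const PT_mult PT_const) (fold PB_def, intro pt_intros)
  then show ?thesis unfolding PB_def
  proof (rule PT_cong)
    fix x \<rho>
    have *: "(\<Sum>j<A'. of_bool (u = i \<and> v = j) * of_bool (Q i j)) =
       (if u = i then of_bool (v < A' \<and> Q i v) else 0 :: nat)" for i u v
      by (auto simp: of_bool_def if_distrib[of "\<lambda>z. z * _"] cong: if_cong)
    show "of_bool (a x \<rho> < A \<and> b x \<rho> < A' \<and> Q (a x \<rho>) (b x \<rho>)) =
       (\<Sum>i<A. \<Sum>j<A'. of_bool (a x \<rho> = i \<and> b x \<rho> = j) * of_bool (Q i j) :: nat)"
      unfolding * by auto
  qed
qed

text \<open>The column loop is the inner one and owns variable \<open>0\<close>, which leaves
  variable \<open>1\<close> to the row.\<close>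

theorem polytime_matrix_code:
  assumes "PT (\<lambda>x \<rho>. k x)" "PT (\<lambda>x \<rho>. s x)" "PT (\<lambda>x \<rho>. n x)" "PB (\<lambda>x \<rho>. E x (\<rho> 1) (\<rho> 0))"
  shows "polytime (\<lambda>x. pair_code (nat_code (k x)) (pair_code (nat_code (s x))
     (pair_code (nat_code (n x)) [E x i j. i \<leftarrow> [0..<n x], j \<leftarrow> [0..<n x]])))"
proof -
  obtain tk ts tn te where t: "\<And>x \<rho>. eval x \<rho> tk = k x" "\<And>x \<rho>. eval x \<rho> ts = s x" "\<And>x \<rho>. eval x \<rho> tn = n x"
    "\<And>x \<rho>. eval x \<rho> te = of_bool (E x (\<rho> 1) (\<rho> 0))"
    using assms unfolding PT_def PB_def by metis
  define z where "z = OBit (Sub One One)"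
  define o1 where "o1 = OApp (ONat tk) (OApp z (OApp (ONat ts) (OApp z (OApp (ONat tn)
     (OApp z (OFor tn (OFor tn (OBit te))))))))"
  have "oeval x (\<lambda>_. 0) o1 = pair_code (nat_code (k x)) (pair_code (nat_code (s x))
     (pair_code (nat_code (n x)) [E x i j. i \<leftarrow> [0..<n x], j \<leftarrow> [0..<n x]]))" for x
    by (simp add: o1_def z_def t pair_code_def)
  then show ?thesis using polytime_oeval[of o1] by simp
qed


section \<open>A clique with elements and pendant leaves, and its large packings\<close>

section \<open>The packing gadget\<close>

lemma closed_nbhd_induced:
  "v \<in> D \<Longrightarrow> closed_nbhd (induced_subgraph H D) v = closed_nbhd H v \<inter> D"
  by (auto simp: closed_nbhd_def induced_subgraph_def)

lemma LP_opt_ge_iff: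
  assumes "finite (verts H)"
  shows "s \<le> LP_opt H k \<longleftrightarrow> (\<exists>B. limited_packing H k B \<and> s \<le> card B)"
proof -
  have "{card B | B. limited_packing H k B} = card ` {B. limited_packing H k B}" by auto
  moreover have "finite {B. limited_packing H k B}"
    by (rule finite_subset[of _ "Pow (verts H)"]) (use assms in \<open>auto simp: limited_packing_def\<close>)
  moreover have "limited_packing H k {}" by (simp add: limited_packing_def)
  ultimately show ?thesis unfolding LP_opt_def by (subst Max_ge_iff) auto
qed

text \<open>\<open>I\<close> are the elements, \<open>Q\<close> is the clique with hub
  \<open>u\<close>, \<open>L\<close> are the leaves, and \<open>S q\<close> are the elements joined
  to \<open>q\<close>. By \<open>cover\<close> and \<open>nonempty\<close> every nonleaf lies in the
  closed neighborhood of some clique vertex other than the hub.\<close>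

locale packing_gadget =
  fixes I Q L :: "'a set" and u :: 'a and par :: "'a \<Rightarrow> 'a" and S :: "'a \<Rightarrow> 'a set" and k :: nat
  assumes fin: "finite I" "finite Q" "finite L"
    and dis: "I \<inter> Q = {}" "I \<inter> L = {}" "Q \<inter> L = {}"
    and u: "u \<in> Q" "S u = I"
    and S: "\<And>q. q \<in> Q \<Longrightarrow> S q \<subseteq> I"
    and par: "\<And>l. l \<in> L \<Longrightarrow> par l \<in> Q - {u}"
    and leaves: "\<And>q. q \<in> Q - {u} \<Longrightarrow> card {l \<in> L. par l = q} = k - 1"
    and cover: "\<And>i. i \<in> I \<Longrightarrow> \<exists>q\<in>Q - {u}. i \<in> S q"
    and nonempty: "Q - {u} \<noteq> {}"
    and k: "2 \<le> k"
begin

definition arc :: "'a \<Rightarrow> 'a \<Rightarrow> bool" where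
  "arc v w \<longleftrightarrow> v \<in> Q \<and> (w \<in> Q \<and> v \<noteq> w \<or> w \<in> S v \<or> w \<in> L \<and> v = par w)"

definition G :: "'a ugraph" where
  "G = \<lparr>verts = I \<union> Q \<union> L, edges = {{v, w} | v w. arc v w}\<rparr>"

lemma verts_G: "verts G = I \<union> Q \<union> L"
  by (simp add: G_def)

lemma edge_iff: "{v, w} \<in> edges G \<longleftrightarrow> arc v w \<or> arc w v"
  by (auto simp: G_def doubleton_eq_iff)

lemma arc_verts: "arc v w \<Longrightarrow> v \<in> verts G \<and> w \<in> verts G \<and> v \<noteq> w"
  using S dis par by (auto simp: arc_def verts_G)

lemma simple: "simple_graph G"
  unfolding simple_graph_def
proof (intro conjI ballI)
  show "finite (verts G)" using fin by (simp add: verts_G)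
  fix e assume "e \<in> edges G"
  then obtain v w where "e = {v, w}" "arc v w" by (auto simp: G_def)
  then show "e \<subseteq> verts G" "card e = 2" using arc_verts by auto
qed

lemma nbhd_leaf: "l \<in> L \<Longrightarrow> closed_nbhd G l = {l, par l}"
  using dis S par by (fastforce simp: closed_nbhd_def edge_iff arc_def verts_G)

lemma nbhd_elem: "i \<in> I \<Longrightarrow> closed_nbhd G i = insert i {q \<in> Q. i \<in> S q}"
  using dis S by (fastforce simp: closed_nbhd_def edge_iff arc_def verts_G)

lemma nbhd_clique: "q \<in> Q \<Longrightarrow> closed_nbhd G q = Q \<union> S q \<union> {l \<in> L. par l = q}"
  using dis S by (fastforce simp: closed_nbhd_def edge_iff arc_def verts_G)

lemma nbhd_hub: "closed_nbhd G u = I \<union> Q"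
  using nbhd_clique[OF u(1)] u par by auto

lemma leaf_edge: "l \<in> L \<Longrightarrow> {l, w} \<in> edges G \<Longrightarrow> w = par l"
  using dis S[of w] by (auto simp: edge_iff arc_def)

lemma elem_edge: "i \<in> I \<Longrightarrow> {i, w} \<in> edges G \<Longrightarrow> w \<in> Q"
  using dis S by (auto simp: edge_iff arc_def)

text \<open>A leaf has one neighbor and lies on no cycle; an element has neighbors only in the
  clique. So some vertex of the cycle has both its cycle neighbors in \<open>Q\<close>, and these
  two are adjacent.\<close>

lemma chordal: "chordal G"
  unfolding chordal_def
proof (intro conjI allI impI simple)
  fix c assume c: "is_cycle G c \<and> 4 \<le> length c"
  let ?n = "length c"
  have n: "4 \<le> ?n" and d: "distinct c" and sub: "set c \<subseteq> verts G"
    and e: "\<And>i. i < ?n \<Longrightarrow> {c ! i, c ! (Suc i mod ?n)} \<in> edges G"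
    using c by (auto simp: is_cycle_def)
  define nx where "nx i = (if Suc i = ?n then 0 else Suc i)" for i
  define pv where "pv i = (if i = 0 then ?n - 1 else i - 1)" for i
  have nx: "Suc i mod ?n = nx i" "nx i < ?n" if "i < ?n" for i using that by (auto simp: nx_def)
  have pv: "pv i < ?n" "nx (pv i) = i" if "i < ?n" for i using that n by (auto simp: nx_def pv_def)
  \<comment> \<open>The second inequality needs length at least 4: in a triangle the two neighbors
    of a vertex are consecutive.\<close>
  have ne: "pv i \<noteq> nx i" "nx (nx i) \<noteq> pv i" if "i < ?n" for i using that n by (auto simp: nx_def pv_def)
  have enx: "{c ! i, c ! nx i} \<in> edges G" if "i < ?n" for i using e[OF that] nx[OF that] by simp
  have epv: "{c ! i, c ! pv i} \<in> edges G" if "i < ?n" for i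
    using enx[of "pv i"] pv[OF that] by (simp add: insert_commute)
  have noL: "c ! i \<notin> L" if "i < ?n" for i
  proof
    assume "c ! i \<in> L"
    then have "c ! nx i = c ! pv i" using leaf_edge enx[OF that] epv[OF that] by metis
    then show False using d nx(2)[OF that] pv(1)[OF that] ne(1)[OF that] by (simp add: nth_eq_iff_index_eq)
  qed
  obtain i where i: "i < ?n" and iq: "c ! nx i \<in> Q" "c ! pv i \<in> Q"
  proof (cases "\<exists>i<?n. c ! i \<in> I")
    case True
    then show ?thesis using elem_edge enx epv that by blast
  next
    case False
    then have "c ! i \<in> Q" if "i < ?n" for i
      using that noL[OF that] subsetD[OF sub nth_mem[OF that]] by (auto simp: verts_G)
    moreover have "0 < ?n" using n by linarith
    ultimately show ?thesis using nx(2) pv(1) that by blast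
  qed
  have "c ! nx i \<noteq> c ! pv i"
    using d nx(2)[OF i] pv(1)[OF i] ne(1)[OF i] by (simp add: nth_eq_iff_index_eq)
  then have "{c ! nx i, c ! pv i} \<in> edges G" using iq by (simp add: edge_iff arc_def)
  moreover have "nx i \<noteq> nx (pv i)" using pv[OF i] i n by (auto simp: nx_def)
  ultimately show "has_chord G c"
    unfolding has_chord_def using nx[OF i] nx(1)[of "nx i"] nx(1)[of "pv i"] pv[OF i] ne[OF i]
    by (intro exI[of _ "nx i"] conjI exI[of _ "pv i"]) auto
qed

text \<open>A leaf has only its parent as further neighbor, so the parent is a maximum neighbor.
  Once the leaves are gone, the hub is adjacent to everything left and serves for all other
  vertices.\<close>

lemma dually_chordal: "dually_chordal G"
proof -
  obtain ls where ls: "set ls = L" "distinct ls" using fin finite_distinct_list by blast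
  obtain qs where qs: "set qs = I \<union> Q - {u}" "distinct qs"
    using fin finite_distinct_list[of "I \<union> Q - {u}"] by blast
  define vs where "vs = ls @ qs @ [u]"
  have "maximum_nbhd_order G vs"
    unfolding maximum_nbhd_order_def
  proof (intro conjI allI impI)
    show "distinct vs" using ls qs dis u by (auto simp: vs_def)
    show "set vs = verts G" using ls qs u by (auto simp: vs_def verts_G)
    fix i assume i: "i < length vs"
    let ?D = "set (drop i vs)" and ?v = "vs ! i"
    have vD: "?v \<in> ?D" using i by (simp add: Cons_nth_drop_Suc[symmetric])
    have uD: "u \<in> ?D" using i by (auto simp: vs_def)
    show "\<exists>w. maximum_neighbor (induced_subgraph G ?D) ?v w"
    proof (cases "i < length ls")
      case True
      then have "?v \<in> set ls" by (simp add: vs_def nth_append)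
      then have l: "?v \<in> L" using ls by simp
      have D: "I \<union> Q \<subseteq> ?D" using True qs by (auto simp: vs_def)
      have p: "par ?v \<in> Q" using par[OF l] by simp
      then have pD: "par ?v \<in> ?D" using D by auto
      have "closed_nbhd G ?v \<subseteq> closed_nbhd G (par ?v)"
        using nbhd_leaf[OF l] nbhd_clique[OF p] l p by auto
      then have "maximum_neighbor (induced_subgraph G ?D) ?v (par ?v)"
        unfolding maximum_neighbor_def closed_nbhd_induced[OF vD] nbhd_leaf[OF l]
        using vD pD nbhd_leaf[OF l] by (auto simp: closed_nbhd_induced)
      then show ?thesis by blast
    next
      case False
      then have "drop i vs = drop (i - length ls) (qs @ [u])" by (simp add: vs_def)
      then have "?D \<subseteq> set (qs @ [u])" by (metis set_drop_subset)
      also have "\<dots> \<subseteq> I \<union> Q" using qs u by auto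
      finally have D: "?D \<subseteq> I \<union> Q" .
      have "u \<in> closed_nbhd G ?v"
        using vD D u nbhd_elem nbhd_clique by auto
      then have "maximum_neighbor (induced_subgraph G ?D) ?v u"
        unfolding maximum_neighbor_def using vD uD D
        by (auto simp: closed_nbhd_induced nbhd_hub)
      then show ?thesis by blast
    qed
  qed
  then show ?thesis unfolding dually_chordal_def using simple by blast
qed

lemma card_leaves: "card L = card (Q - {u}) * (k - 1)"
proof -
  have "card L = (\<Sum>l\<in>L. 1)" by simp
  also have "\<dots> = (\<Sum>q\<in>Q - {u}. \<Sum>l | l \<in> L \<and> par l = q. 1)"
    by (rule sum.group[symmetric]) (use fin par in auto)
  also have "\<dots> = (\<Sum>q\<in>Q - {u}. k - 1)" using leaves by (intro sum.cong) auto
  finally show ?thesis by simp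
qed

text \<open>The threshold is the number of leaves plus the \<open>k\<close> vertices the hub allows
  among the nonleaves, so reaching it forces equality in both counts.\<close>

lemma LP_opt_G:
  "k + card (Q - {u}) * (k - 1) \<le> LP_opt G k \<longleftrightarrow>
     (\<exists>X\<subseteq>I. card X = k \<and> (\<forall>q\<in>Q - {u}. card (S q \<inter> X) \<le> 1))" (is "?l \<longleftrightarrow> ?r")
proof -
  have finG: "finite (verts G)" using fin by (simp add: verts_G)
  have "?l \<longleftrightarrow> (\<exists>B. limited_packing G k B \<and> k + card L \<le> card B)"
    using LP_opt_ge_iff[OF finG] card_leaves by simp
  also have "\<dots> \<longleftrightarrow> ?r"
  proof
    assume "\<exists>B. limited_packing G k B \<and> k + card L \<le> card B"
    then obtain B where B: "B \<subseteq> verts G" "\<And>v. v \<in> verts G \<Longrightarrow> card (closed_nbhd G v \<inter> B) \<le> k"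
      "k + card L \<le> card B" by (auto simp: limited_packing_def)
    have finB: "finite B" using B(1) finG finite_subset by blast
    define X where "X = (I \<union> Q) \<inter> B"
    have Xk: "card X \<le> k" using B(2)[of u] u nbhd_hub by (simp add: verts_G X_def)
    have "B = X \<union> (B \<inter> L)" using B(1) by (auto simp: X_def verts_G)
    then have "card B \<le> card X + card (B \<inter> L)" by (metis card_Un_le)
    moreover have "card (B \<inter> L) \<le> card L" using fin by (intro card_mono) auto
    ultimately have X: "card X = k" and "card (B \<inter> L) = card L" using Xk B(3) by linarith+
    then have LB: "L \<subseteq> B" using fin by (metis card_subset_eq inf_le1 inf_le2)
    \<comment> \<open>The \<open>k - 1\<close> leaves at \<open>q\<close> are all packed, which
      leaves room for one more vertex in its closed neighborhood.\<close>
    have one: "card ((Q \<union> S q) \<inter> B) \<le> 1" if q: "q \<in> Q - {u}" for q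
    proof -
      have "closed_nbhd G q \<inter> B = ((Q \<union> S q) \<inter> B) \<union> {l \<in> L. par l = q}"
        using nbhd_clique q LB by auto
      moreover have "((Q \<union> S q) \<inter> B) \<inter> {l \<in> L. par l = q} = {}" using dis S q by blast
      ultimately have "card (closed_nbhd G q \<inter> B) = card ((Q \<union> S q) \<inter> B) + (k - 1)"
        using fin finB leaves[OF q] by (simp add: card_Un_disjoint)
      then show ?thesis using B(2)[of q] q k by (simp add: verts_G)
    qed
    have two: False if "q \<in> Q - {u}" "a \<in> Q \<union> S q" "b \<in> Q \<union> S q" "a \<in> B" "b \<in> B" "a \<noteq> b" for q a b
    proof -
      have "card {a, b} \<le> card ((Q \<union> S q) \<inter> B)" using that finB by (intro card_mono) auto
      then show False using one[OF that(1)] that(6) by simp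
    qed
    have "w \<notin> B" if w: "w \<in> Q" for w
    proof
      assume wB: "w \<in> B"
      \<comment> \<open>As \<open>k \<ge> 2\<close>, a packed clique vertex \<open>w\<close> has a
        packed companion \<open>b\<close> outside the leaves. Some nonhub \<open>q\<close> sees
        \<open>b\<close>, and like all of the clique it sees \<open>w\<close>, contrary to
        \<open>two\<close>.\<close>
      have "\<not> X \<subseteq> {w}" using card_mono[of "{w}" X] X k by auto
      then obtain b where b: "b \<in> X" "b \<noteq> w" by blast
      then have "\<exists>q\<in>Q - {u}. b \<in> Q \<union> S q" using cover nonempty by (auto simp: X_def)
      then show False using two w wB b by (auto simp: X_def)
    qed
    then have "X \<subseteq> I" by (auto simp: X_def)
    moreover have "card (S q \<inter> X) \<le> 1" if "q \<in> Q - {u}" for q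
    proof -
      have "card (S q \<inter> X) \<le> card ((Q \<union> S q) \<inter> B)" using finB by (intro card_mono) (auto simp: X_def)
      then show ?thesis using one[OF that] by simp
    qed
    ultimately show ?r using X by blast
  next
    assume ?r
    then obtain X where X: "X \<subseteq> I" "card X = k" "\<And>q. q \<in> Q - {u} \<Longrightarrow> card (S q \<inter> X) \<le> 1" by blast
    have finX: "finite X" using X(1) fin finite_subset by blast
    have "card (closed_nbhd G v \<inter> (X \<union> L)) \<le> k" if v: "v \<in> verts G" for v
    proof -
      consider "v \<in> I" | "v = u" | "v \<in> Q - {u}" | "v \<in> L" using v by (auto simp: verts_G)
      then show ?thesis
      proof cases
        case 1
        then have "closed_nbhd G v \<inter> (X \<union> L) \<subseteq> X" using nbhd_elem dis by auto
        then show ?thesis using card_mono[OF finX] X(2) by blast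
      next
        case 2
        then have "closed_nbhd G v \<inter> (X \<union> L) \<subseteq> X" using nbhd_hub dis by auto
        then show ?thesis using card_mono[OF finX] X(2) by blast
      next
        case 3
        then have "closed_nbhd G v \<inter> (X \<union> L) \<subseteq> (S v \<inter> X) \<union> {l \<in> L. par l = v}"
          using nbhd_clique[of v] dis X(1) S[of v] by auto
        then have "card (closed_nbhd G v \<inter> (X \<union> L)) \<le> card ((S v \<inter> X) \<union> {l \<in> L. par l = v})"
          using finX fin by (intro card_mono) auto
        also have "\<dots> \<le> card (S v \<inter> X) + card {l \<in> L. par l = v}" by (rule card_Un_le)
        also have "\<dots> \<le> 1 + (k - 1)" using X(3)[OF 3] leaves[OF 3] by simp
        finally show ?thesis using k by simp
      next
        case 4
        then have "card (closed_nbhd G v \<inter> (X \<union> L)) \<le> card {v, par v}"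
          using nbhd_leaf by (intro card_mono) auto
        also have "\<dots> \<le> 2" by (simp add: card_insert_if)
        finally show ?thesis using k by simp
      qed
    qed
    then have "limited_packing G k (X \<union> L)" using X(1) by (auto simp: limited_packing_def verts_G)
    moreover have "X \<inter> L = {}" using X(1) dis by auto
    then have "card (X \<union> L) = k + card L" using X(2) finX fin by (simp add: card_Un_disjoint)
    ultimately show "\<exists>B. limited_packing G k B \<and> k + card L \<le> card B" by (metis order_refl)
  qed
  finally show ?thesis .
qed

end

section \<open>An arithmetic copy of the gadget on an initial segment of the naturals\<close>

subsection \<open>Numbering the vertices\<close>

text \<open>
  The elements are \<open>{..<m}\<close>, the hub is \<open>m\<close>, and the clique vertex of the pair \<open>(i, j)\<close> is
  \<open>m + 1 + (i * m + j) * k\<close>, followed by its \<open>k - 1\<close> leaves.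
\<close>

definition gad_n :: "nat \<Rightarrow> nat \<Rightarrow> nat" where
  "gad_n m k = Suc m + m * m * k"

definition gad_s :: "nat \<Rightarrow> nat \<Rightarrow> nat" where
  "gad_s m k = k + m * m * (k - 1)"

definition gad_clique :: "nat \<Rightarrow> nat \<Rightarrow> nat \<Rightarrow> bool" where
  "gad_clique m k v \<longleftrightarrow> m \<le> v \<and> (v = m \<or> (v - Suc m) mod k = 0)"

text \<open>The first element of a pair is seen unconditionally, so every element is covered even if
  it is in no conflict.\<close>

definition gad_sees :: "nat \<Rightarrow> nat \<Rightarrow> (nat \<Rightarrow> nat \<Rightarrow> bool) \<Rightarrow> nat \<Rightarrow> nat \<Rightarrow> bool" where
  "gad_sees m k C v i \<longleftrightarrow> i < m \<and> (v = m \<or> i = (v - Suc m) div k div m \<or>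
     i = (v - Suc m) div k mod m \<and> C ((v - Suc m) div k div m) ((v - Suc m) div k mod m))"

text \<open>Matches \<open>packing_gadget.arc\<close> but uses only arithmetic and \<open>C\<close>,
  so that the adjacency matrix is definable by terms.\<close>

definition gad_arc :: "nat \<Rightarrow> nat \<Rightarrow> (nat \<Rightarrow> nat \<Rightarrow> bool) \<Rightarrow> nat \<Rightarrow> nat \<Rightarrow> bool" where
  "gad_arc m k C v w \<longleftrightarrow> gad_clique m k v \<and> (gad_clique m k w \<and> v \<noteq> w \<or> gad_sees m k C v w \<or>
     m < w \<and> \<not> gad_clique m k w \<and> v = Suc m + (w - Suc m) div k * k)"

lemma gadget_graph:
  assumes m: "0 < m" and k: "2 \<le> k"
  obtains G where "doubly_chordal G" "verts G = {..<gad_n m k}"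
    "\<And>v w. v < gad_n m k \<Longrightarrow> w < gad_n m k \<Longrightarrow>
       {v, w} \<in> edges G \<longleftrightarrow> gad_arc m k C v w \<or> gad_arc m k C w v"
    "gad_s m k \<le> LP_opt G k \<longleftrightarrow> (\<exists>X\<subseteq>{..<m}. card X = k \<and> (\<forall>i\<in>X. \<forall>j\<in>X. i \<noteq> j \<longrightarrow> \<not> C i j))"
proof -
  let ?n = "gad_n m k"
  define Q where "Q = {v. v < ?n \<and> gad_clique m k v}"
  define L where "L = {v. v < ?n \<and> m < v \<and> \<not> gad_clique m k v}"
  define par where "par w = Suc m + (w - Suc m) div k * k" for w
  define S where "S v = {i. gad_sees m k C v i}" for v
  define cl where "cl a = Suc m + a * k" for a
  have Qm: "Q - {m} = cl ` {..<m * m}"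
  proof (intro equalityI subsetI)
    fix v assume "v \<in> Q - {m}"
    then have v: "m < v" "v < ?n" "(v - Suc m) mod k = 0" by (auto simp: Q_def gad_clique_def)
    then have "v = cl ((v - Suc m) div k)" by (auto simp: cl_def mult.commute[of _ k])
    moreover have "(v - Suc m) div k < m * m"
      using v k by (auto simp: gad_n_def less_mult_imp_div_less)
    ultimately show "v \<in> cl ` {..<m * m}" by blast
  next
    fix v assume "v \<in> cl ` {..<m * m}"
    then obtain a where "a < m * m" "v = cl a" by auto
    moreover then have "a * k < m * m * k" using k by simp
    ultimately show "v \<in> Q - {m}" by (auto simp: Q_def gad_clique_def cl_def gad_n_def)
  qed
  have inj: "inj cl" using k by (auto simp: inj_def cl_def)
  have clk [simp]: "(cl a - Suc m) div k = a" for a using k by (simp add: cl_def)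
  have clm [simp]: "cl a \<noteq> m" for a by (simp add: cl_def)
  have ij: "(i * m + j) div m = i" "(i * m + j) mod m = j" "i * m + j < m * m" if "i < m" "j < m" for i j
  proof -
    have "i * m + j < Suc i * m" using that by simp
    also have "\<dots> \<le> m * m" using that by (intro mult_le_mono1) simp
    finally show "i * m + j < m * m" .
  qed (use that in auto)
  interpret packing_gadget "{..<m}" Q L m par S k
  proof
    show "finite Q" "finite L" by (auto simp: Q_def L_def)
    show "{..<m} \<inter> Q = {}" "{..<m} \<inter> L = {}" "Q \<inter> L = {}"
      by (auto simp: Q_def L_def gad_clique_def)
    show "m \<in> Q" by (simp add: Q_def gad_clique_def gad_n_def)
    show "S m = {..<m}" by (auto simp: S_def gad_sees_def)
    show "S q \<subseteq> {..<m}" for q by (auto simp: S_def gad_sees_def)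
    show "par l \<in> Q - {m}" if "l \<in> L" for l
    proof -
      have "(l - Suc m) div k < m * m" using that k by (auto simp: L_def gad_n_def less_mult_imp_div_less)
      then show ?thesis unfolding Qm par_def cl_def by blast
    qed
    show "card {l \<in> L. par l = q} = k - 1" if q: "q \<in> Q - {m}" for q
    proof -
      obtain a where a: "a < m * m" "q = cl a" using q Qm by auto
      have "{l \<in> L. par l = q} = (\<lambda>r. cl a + r) ` {1..<k}"
      proof (intro equalityI subsetI)
        fix l assume "l \<in> {l \<in> L. par l = q}"
        then have l: "m < l" "(l - Suc m) mod k \<noteq> 0" "par l = cl a" by (auto simp: L_def gad_clique_def a)
        have "l = par l + (l - Suc m) mod k"
          using l(1) by (simp add: par_def)
        then show "l \<in> (\<lambda>r. cl a + r) ` {1..<k}" using l k by (intro image_eqI[of _ _ "(l - Suc m) mod k"]) auto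
      next
        fix l assume "l \<in> (\<lambda>r. cl a + r) ` {1..<k}"
        then obtain r where r: "1 \<le> r" "r < k" "l = cl a + r" by (metis atLeastLessThan_iff imageE)
        have "a * k + r < Suc a * k" using r by simp
        also have "\<dots> \<le> m * m * k" using a(1) by (intro mult_le_mono1) simp
        finally have "l < ?n" by (simp add: r cl_def gad_n_def)
        moreover have "l - Suc m = a * k + r" by (simp add: r cl_def)
        ultimately show "l \<in> {l \<in> L. par l = q}"
          using r a by (auto simp: L_def gad_clique_def par_def cl_def)
      qed
      moreover have "inj_on (\<lambda>r. cl a + r) {1..<k}" by (simp add: inj_on_def)
      ultimately show ?thesis by (simp add: card_image)
    qed
    show "\<exists>q\<in>Q - {m}. i \<in> S q" if "i \<in> {..<m}" for i
      unfolding Qm using that ij[of i 0] m by (intro bexI[of _ "cl (i * m + 0)"]) (auto simp: S_def gad_sees_def)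
    show "Q - {m} \<noteq> {}" unfolding Qm using m by (auto simp: lessThan_empty_iff)
  qed (use k in auto)
  have V: "{..<m} \<union> Q \<union> L = {..<?n}"
    by (auto simp: Q_def L_def gad_clique_def gad_n_def)
  have arc: "arc v w \<longleftrightarrow> gad_arc m k C v w" if "v < ?n" "w < ?n" for v w
    unfolding arc_def gad_arc_def using that by (auto simp: Q_def L_def S_def par_def)
  have card: "card (Q - {m}) = m * m" unfolding Qm using inj by (simp add: card_image inj_on_subset)
  \<comment> \<open>The vertex of the pair \<open>(i, j)\<close> sees at most \<open>i\<close> and
    \<open>j\<close>, and sees both distinct elements only if \<open>C i j\<close>.\<close>
  have one: "(\<forall>q\<in>Q - {m}. card (S q \<inter> X) \<le> 1) \<longleftrightarrow> (\<forall>i\<in>X. \<forall>j\<in>X. i \<noteq> j \<longrightarrow> \<not> C i j)"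
    if X: "X \<subseteq> {..<m}" for X
  proof
    assume l: "\<forall>q\<in>Q - {m}. card (S q \<inter> X) \<le> 1"
    show "\<forall>i\<in>X. \<forall>j\<in>X. i \<noteq> j \<longrightarrow> \<not> C i j"
    proof (intro ballI impI notI)
      fix i j assume h: "i \<in> X" "j \<in> X" "i \<noteq> j" "C i j"
      then have "i < m" "j < m" using X by auto
      note d = ij[OF this]
      have "{i, j} \<subseteq> S (cl (i * m + j)) \<inter> X"
        using h \<open>i < m\<close> \<open>j < m\<close> d by (auto simp: S_def gad_sees_def)
      then have "card {i, j} \<le> card (S (cl (i * m + j)) \<inter> X)"
        using X finite_subset by (intro card_mono) auto
      also have "\<dots> \<le> 1" using l d(3) unfolding Qm by blast
      finally show False using h(3) by simp
    qed
  next
    assume r: "\<forall>i\<in>X. \<forall>j\<in>X. i \<noteq> j \<longrightarrow> \<not> C i j"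
    show "\<forall>q\<in>Q - {m}. card (S q \<inter> X) \<le> 1"
    proof
      fix q assume "q \<in> Q - {m}"
      then have "q \<noteq> m" by simp
      have "a = b" if "a \<in> S q \<inter> X" "b \<in> S q \<inter> X" for a b
        using that r \<open>q \<noteq> m\<close> unfolding S_def gad_sees_def by (auto; metis)
      then show "card (S q \<inter> X) \<le> 1"
        using X finite_subset by (subst One_nat_def, subst card_le_Suc0_iff_eq) auto
    qed
  qed
  show ?thesis
  proof (rule that[of G])
    show "doubly_chordal G" using chordal dually_chordal by (simp add: doubly_chordal_def)
    show "verts G = {..<?n}" using V by (simp add: verts_G)
    show "{v, w} \<in> edges G \<longleftrightarrow> gad_arc m k C v w \<or> gad_arc m k C w v" if "v < ?n" "w < ?n" for v w
      using that arc edge_iff by simp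
    show "gad_s m k \<le> LP_opt G k \<longleftrightarrow> (\<exists>X\<subseteq>{..<m}. card X = k \<and> (\<forall>i\<in>X. \<forall>j\<in>X. i \<noteq> j \<longrightarrow> \<not> C i j))"
      using LP_opt_G one by (auto simp: gad_s_def card)
  qed
qed


section \<open>Conflict-free sets as solutions of binary constraints\<close>

section \<open>Binary constraint satisfaction\<close>

text \<open>Element \<open>e\<close> stands for giving value \<open>e mod A\<close> to variable
  \<open>e div A\<close>. Two values of one variable conflict, so by counting \<open>k\<close>
  conflict-free elements pick exactly one value for each of the \<open>k\<close> variables.\<close>

lemma csp_choice:
  fixes bad :: "nat \<Rightarrow> nat \<Rightarrow> bool" and viol :: "nat \<Rightarrow> nat \<Rightarrow> nat \<Rightarrow> nat \<Rightarrow> bool"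
  assumes A: "0 < A" and k: "2 \<le> k"
    and C: "\<And>e e'. C e e' \<longleftrightarrow> bad (e div A) (e mod A) \<or> e div A = e' div A \<or>
       viol (e div A) (e mod A) (e' div A) (e' mod A)"
  shows "(\<exists>X\<subseteq>{..<k * A}. card X = k \<and> (\<forall>i\<in>X. \<forall>j\<in>X. i \<noteq> j \<longrightarrow> \<not> C i j)) \<longleftrightarrow>
    (\<exists>val. (\<forall>v<k. val v < A \<and> \<not> bad v (val v)) \<and> (\<forall>v<k. \<forall>w<k. v \<noteq> w \<longrightarrow> \<not> viol v (val v) w (val w)))"
    (is "?l \<longleftrightarrow> ?r")
proof
  assume ?l
  then obtain X where X: "X \<subseteq> {..<k * A}" "card X = k" "\<And>i j. i \<in> X \<Longrightarrow> j \<in> X \<Longrightarrow> i \<noteq> j \<Longrightarrow> \<not> C i j" by blast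
  have inj: "inj_on (\<lambda>e. e div A) X" using X(3) by (auto simp: inj_on_def C)
  have "(\<lambda>e. e div A) ` X \<subseteq> {..<k}" using X(1) by (auto simp: less_mult_imp_div_less)
  moreover have "card ((\<lambda>e. e div A) ` X) = k" using inj X(2) by (simp add: card_image)
  ultimately have "(\<lambda>e. e div A) ` X = {..<k}" by (intro card_subset_eq) auto
  then have "\<forall>v<k. \<exists>e\<in>X. e div A = v" by (metis (no_types, lifting) image_iff lessThan_iff)
  then obtain g where g: "\<And>v. v < k \<Longrightarrow> g v \<in> X" "\<And>v. v < k \<Longrightarrow> g v div A = v" by metis
  have nc: "\<not> C (g v) (g w)" if "v < k" "w < k" "v \<noteq> w" for v w using X(3) g that by metis
  show ?r
  proof (intro exI[of _ "\<lambda>v. g v mod A"] conjI allI impI)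
    fix v assume v: "v < k"
    show "g v mod A < A" using A by simp
    \<comment> \<open>A forbidden value shows up only as a conflict with some other chosen element,
      so a second variable is needed.\<close>
    obtain w where "w < k" "w \<noteq> v"
    proof (cases "v = 0")
      case True
      then show ?thesis using that[of 1] k by simp
    next
      case False
      then show ?thesis using that[of 0] k by simp
    qed
    from nc[OF v this(1) this(2)[symmetric]] show "\<not> bad v (g v mod A)" using g(2)[OF v] by (simp add: C)
  next
    fix v w assume v: "v < k" "w < k" "v \<noteq> w"
    from nc[OF this] show "\<not> viol v (g v mod A) w (g w mod A)" using g(2) v by (simp add: C)
  qed
next
  assume ?r
  then obtain val where val: "\<And>v. v < k \<Longrightarrow> val v < A" "\<And>v. v < k \<Longrightarrow> \<not> bad v (val v)"
    "\<And>v w. v < k \<Longrightarrow> w < k \<Longrightarrow> v \<noteq> w \<Longrightarrow> \<not> viol v (val v) w (val w)" by blast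
  define g where "g v = v * A + val v" for v
  have g: "g v div A = v" "g v mod A = val v" "g v < k * A" if "v < k" for v
  proof -
    have "g v < Suc v * A" using val(1)[OF that] by (simp add: g_def)
    also have "\<dots> \<le> k * A" using that by (intro mult_le_mono1) simp
    finally show "g v < k * A" .
  qed (use val(1)[OF that] in \<open>auto simp: g_def\<close>)
  have "inj_on g {..<k}" using g(1) by (metis inj_onI lessThan_iff)
  then have "card (g ` {..<k}) = k" by (simp add: card_image)
  moreover have "g ` {..<k} \<subseteq> {..<k * A}" using g(3) by auto
  moreover have "\<not> C i j" if ij: "i \<in> g ` {..<k}" "j \<in> g ` {..<k}" "i \<noteq> j" for i j
  proof -
    obtain v w where "v < k" "w < k" "i = g v" "j = g w" "v \<noteq> w" using ij by auto
    then show ?thesis using g val by (simp add: C)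
  qed
  ultimately show ?l by blast
qed

section \<open>Tableaux of Turing machine runs in head-relative coordinates\<close>

section \<open>Computations as constraint satisfaction\<close>

type_synonym cell = "nat \<times> nat list \<times> nat list"

lemma content_of_less: "content_of x i < 3"
  by (simp add: content_of_def)

lemma length_prefixed: "length (prefixed x) = 2 * length x"
  by (induction x) auto

lemma nth_prefixed: "i < 2 * length x \<Longrightarrow> prefixed x ! i = (if even i then True else x ! (i div 2))"
proof (induction x arbitrary: i)
  case (Cons b x)
  consider "i = 0" | "i = 1" | j where "i = Suc (Suc j)" by (metis One_nat_def not0_implies_Suc)
  then show ?case using Cons by cases auto
qed simp

lemma content_of_int: "content_of x (int i) = (if i < length x then if x ! i then 2 else 1 else 0)"
  by (simp add: content_of_def)

text \<open>The shape of the paired input, cell by cell, on which the constraints for row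
  \<open>0\<close> are modelled.\<close>

lemma content_pair_code:
  "content_of (pair_code x y) (int i) =
    (if i < 2 * length x then (if even i then 2 else content_of x (int (i div 2)))
     else if i = 2 * length x then 1 else content_of y (int (i - Suc (2 * length x))))"
proof -
  consider "i < 2 * length x" | "i = 2 * length x" | j where "i = 2 * length x + Suc j"
    by (metis less_imp_Suc_add linorder_neqE_nat add_Suc_right)
  then show ?thesis
    unfolding content_of_int pair_code_def
  proof cases
    case 1
    then have "i div 2 < length x" by simp
    then show "(if i < length (prefixed x @ False # y) then if (prefixed x @ False # y) ! i then 2 else 1 else 0) =
      (if i < 2 * length x then if even i then 2 else
         if i div 2 < length x then if x ! (i div 2) then 2 else 1 else 0
       else if i = 2 * length x then 1
       else if i - Suc (2 * length x) < length y then if y ! (i - Suc (2 * length x)) then 2 else 1 else (0 :: nat))"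
      using 1 by (simp add: nth_append length_prefixed nth_prefixed)
  qed (auto simp: nth_append length_prefixed)
qed

lemma length_pair_code: "length (pair_code x y) = 2 * length x + 1 + length y"
  by (simp add: pair_code_def length_prefixed)

locale machine =
  fixes M :: tm
  assumes tm: "turing_machine M"
begin

text \<open>Halting is turned into an idle action, so that one rule governs all rows of the
  tableau.\<close>

definition act :: "nat \<Rightarrow> nat list \<Rightarrow> nat \<times> (nat \<times> move) list" where
  "act q rs = (if q < states M then delta M q rs else (q, map (\<lambda>r. (r, No_Move)) rs))"

definition syms :: "nat list \<Rightarrow> bool" where
  "syms rs \<longleftrightarrow> length rs = tapes M \<and> (\<forall>i<tapes M. rs ! i < symbols M)"

lemma act_wf:
  assumes "q \<le> states M" "syms rs"
  shows "fst (act q rs) \<le> states M" "length (snd (act q rs)) = tapes M"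
    "i < tapes M \<Longrightarrow> fst (snd (act q rs) ! i) < symbols M"
proof -
  have rs: "length rs = tapes M" "set rs \<subseteq> {..<symbols M}"
    using assms(2) by (auto simp: syms_def in_set_conv_nth)
  have "fst (act q rs) \<le> states M \<and> length (snd (act q rs)) = tapes M \<and>
     (\<forall>p\<in>set (snd (act q rs)). fst p < symbols M)"
  proof (cases "q < states M")
    case True
    then show ?thesis using tm rs unfolding turing_machine_def act_def by (fastforce split: prod.splits)
  next
    case False
    then show ?thesis using rs assms by (auto simp: act_def)
  qed
  then show "fst (act q rs) \<le> states M" "length (snd (act q rs)) = tapes M"
    "i < tapes M \<Longrightarrow> fst (snd (act q rs) ! i) < symbols M" by auto
qed

definition wf_config :: "config \<Rightarrow> bool" where
  "wf_config = (\<lambda>(q, ts). q \<le> states M \<and> length ts = tapes M \<and>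
     (\<forall>i<tapes M. \<forall>j. fst (ts ! i) j < symbols M))"

lemma wf_read: "wf_config (q, ts) \<Longrightarrow> syms (map read_tape ts)"
  by (auto simp: wf_config_def syms_def read_tape_def split_beta)

lemma tm_step_act:
  "wf_config (q, ts) \<Longrightarrow> tm_step M (q, ts) =
     (fst (act q (map read_tape ts)), map2 act_tape (snd (act q (map read_tape ts))) ts)"
  by (auto simp: tm_step_def act_def split_beta wf_config_def act_tape_def read_tape_def intro!: nth_equalityI)

lemma step_tape:
  assumes "wf_config (q, ts)" "i < tapes M"
  shows "snd (tm_step M (q, ts)) ! i = act_tape (snd (act q (map read_tape ts)) ! i) (ts ! i)"
  using assms act_wf(2)[OF _ wf_read, of q q ts] by (simp add: tm_step_act wf_config_def)

lemma wf_step: "wf_config cf \<Longrightarrow> wf_config (tm_step M cf)"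
proof -
  assume wf: "wf_config cf"
  obtain q ts where cf: "cf = (q, ts)" by (cases cf)
  have q: "q \<le> states M" and s: "syms (map read_tape ts)" using wf wf_read cf by (auto simp: wf_config_def)
  have "fst (snd (tm_step M cf) ! i) j < symbols M" if "i < tapes M" for i j
    using step_tape[OF wf[unfolded cf] that] act_wf(3)[OF q s that] wf that
    by (auto simp: cf act_tape_def split_beta wf_config_def)
  then show ?thesis using act_wf(1,2)[OF q s] wf
    by (auto simp: cf tm_step_act wf_config_def)
qed

lemma tapes_pos: "0 < tapes M" and symbols_ge: "3 \<le> symbols M"
  using tm by (auto simp: turing_machine_def)

definition config_at :: "bool list \<Rightarrow> nat \<Rightarrow> config" where
  "config_at w t = (tm_step M ^^ t) (tm_init M w)"

lemma config_at_Suc: "config_at w (Suc t) = tm_step M (config_at w t)"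
  by (simp add: config_at_def)

lemma init_tape: "i < tapes M \<Longrightarrow> snd (tm_init M w) ! i = (if i = 0 then (content_of w, 0) else (content_of [], 0))"
  by (auto simp: tm_init_def nth_Cons split: nat.split)

lemma wf_config_at: "wf_config (config_at w t)"
proof (induction t)
  case 0
  have "content_of v j < symbols M" for v j using content_of_less[of v j] symbols_ge by simp
  then have "\<forall>i<tapes M. \<forall>j. fst (snd (tm_init M w) ! i) j < symbols M" using init_tape by simp
  then show ?case using tapes_pos by (auto simp: config_at_def wf_config_def tm_init_def)
qed (simp add: config_at_Suc wf_step)

lemma config_at_head: "i < tapes M \<Longrightarrow> \<bar>snd (snd (config_at w t) ! i)\<bar> \<le> int t"
proof (induction t)
  case 0
  then show ?case by (simp add: config_at_def init_tape)
next
  case (Suc t)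
  obtain q ts where c: "config_at w t = (q, ts)" by (cases "config_at w t")
  let ?m = "snd (snd (act q (map read_tape ts)) ! i)"
  have "\<bar>head_shift ?m\<bar> \<le> 1" by (cases ?m) auto
  moreover have "\<bar>snd (ts ! i)\<bar> \<le> int t" using Suc c by simp
  ultimately have "\<bar>snd (ts ! i) + head_shift ?m\<bar> \<le> int (Suc t)" by linarith
  then show ?case
    using step_tape[of q ts i] wf_config_at[of w t] Suc.prems c
    by (simp add: config_at_Suc act_tape_def split_beta)
qed

text \<open>A cell repeats the state and the symbols under all heads, so that it determines the
  action by itself. The offset is taken on each tape from that tape's own head.\<close>

definition view :: "config \<Rightarrow> int \<Rightarrow> cell" where
  "view = (\<lambda>(q, ts) off. (q, map read_tape ts, map (\<lambda>(c, h). c (h + off)) ts))"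

definition cells :: "cell set" where
  "cells = {(q, rs, ss). q \<le> states M \<and> syms rs \<and> syms ss}"

lemma view_cells: "wf_config cf \<Longrightarrow> view cf off \<in> cells"
  using wf_read[of "fst cf" "snd cf"]
  by (auto simp: view_def cells_def wf_config_def syms_def split_beta)

lemma finite_cells: "finite cells"
proof -
  have "cells \<subseteq> {..states M} \<times> {rs. set rs \<subseteq> {..<symbols M} \<and> length rs = tapes M} \<times>
     {rs. set rs \<subseteq> {..<symbols M} \<and> length rs = tapes M}"
    by (auto simp: cells_def syms_def in_set_conv_nth)
  then show ?thesis by (rule finite_subset) (simp add: finite_lists_length_eq)
qed

definition same :: "cell \<Rightarrow> cell \<Rightarrow> bool" where
  "same = (\<lambda>(q, rs, ss) (q', rs', ss'). q = q' \<and> rs = rs')"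

definition next_state :: "cell \<Rightarrow> cell \<Rightarrow> bool" where
  "next_state = (\<lambda>(q, rs, ss) (q', rs', ss'). q' = fst (act q rs))"

text \<open>Tapes may move differently, so each move gets its own constraint between two cells,
  binding only the tapes that make this move. The flag \<open>z\<close> marks the cell under the
  heads, where the new symbol is written.\<close>

definition shifted :: "bool \<Rightarrow> move \<Rightarrow> cell \<Rightarrow> cell \<Rightarrow> bool" where
  "shifted z m = (\<lambda>(q, rs, ss) (q', rs', ss'). \<forall>i<tapes M. snd (snd (act q rs) ! i) = m \<longrightarrow>
     ss' ! i = (if z then fst (snd (act q rs) ! i) else ss ! i))"

text \<open>The symbol stays in place while the head moves, so its offset drops by the head
  shift.\<close>

lemma view_shift:
  assumes wf: "wf_config (q, ts)" and i: "i < tapes M"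
  defines "a \<equiv> snd (act q (map read_tape ts)) ! i"
  shows "snd (snd (view (tm_step M (q, ts)) (off - head_shift (snd a)))) ! i =
     (if off = 0 then fst a else snd (snd (view (q, ts) off)) ! i)"
proof -
  have "length ts = tapes M" "length (snd (tm_step M (q, ts))) = tapes M"
    using wf wf_step[OF wf] by (auto simp: wf_config_def)
  then show ?thesis using step_tape[OF wf i] i
    by (simp add: view_def split_beta act_tape_def a_def)
qed

lemma shifted_view:
  assumes "wf_config cf"
  shows "shifted (off = 0) m (view cf off) (view (tm_step M cf) (off - head_shift m))"
proof -
  obtain q ts where cf: "cf = (q, ts)" by (cases cf)
  show ?thesis
    using view_shift[of q ts _ off] assms cf by (auto simp: shifted_def view_def split_beta)
qed

text \<open>
  Cells are addressed relative to the heads, so a head move shifts the whole tape. The symbols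
  that enter at the border are unconstrained, but at time \<open>t\<close> they are at distance more than
  \<open>R - t\<close> from the heads.
\<close>

lemma light_cone:
  fixes c :: "nat \<Rightarrow> nat \<Rightarrow> cell"
  assumes cells: "\<And>t p. t \<le> T \<Longrightarrow> p < 2 * R + 1 \<Longrightarrow> c t p \<in> cells"
    and init: "\<And>p. p < 2 * R + 1 \<Longrightarrow> fst (c 0 p) = 0 \<and> snd (snd (c 0 p)) = snd (snd (view (config_at w 0) (int p - int R)))"
    and same: "\<And>t p p'. t \<le> T \<Longrightarrow> p < 2 * R + 1 \<Longrightarrow> p' < 2 * R + 1 \<Longrightarrow> p \<noteq> p' \<Longrightarrow> same (c t p) (c t p')"
    and center: "\<And>t. t \<le> T \<Longrightarrow> fst (snd (c t R)) = snd (snd (c t R))"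
    and nxt: "\<And>t p p'. t < T \<Longrightarrow> p < 2 * R + 1 \<Longrightarrow> p' < 2 * R + 1 \<Longrightarrow> next_state (c t p) (c (Suc t) p')"
    and shift: "\<And>t p p' m. t < T \<Longrightarrow> p < 2 * R + 1 \<Longrightarrow> p' < 2 * R + 1 \<Longrightarrow> int p = int p' + head_shift m \<Longrightarrow>
        shifted (p = R) m (c t p) (c (Suc t) p')"
    and TR: "T \<le> R"
  shows "t \<le> T \<Longrightarrow> p < 2 * R + 1 \<Longrightarrow> \<bar>int p - int R\<bar> \<le> int R - int t \<Longrightarrow>
     c t p = view (config_at w t) (int p - int R)"
proof (induction t arbitrary: p)
  case 0
  have same0: "same (c 0 p) (c 0 R)" using same[of 0 p R] 0 by (cases "p = R") (auto simp: same_def)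
  have "fst (snd (c 0 R)) = snd (snd (view (config_at w 0) 0))" using center[of 0] init[of R] by simp
  also have "\<dots> = fst (snd (view (config_at w 0) 0))"
    by (auto simp: view_def read_tape_def split_beta)
  finally have "fst (snd (c 0 p)) = fst (snd (view (config_at w 0) 0))" using same0 by (auto simp: same_def split_beta)
  then show ?case using init[of p] 0
    by (auto simp: view_def split_beta prod_eq_iff config_at_def tm_init_def)
next
  case (Suc t)
  obtain q ts where cf: "config_at w t = (q, ts)" by (cases "config_at w t")
  note wf = wf_config_at[of w t, unfolded cf]
  let ?cf' = "config_at w (Suc t)"
  have cf': "?cf' = tm_step M (q, ts)" using cf by (simp add: config_at_Suc)
  have t: "t < T" "t \<le> T" using Suc.prems by auto
  \<comment> \<open>The center is inside the cone because \<open>T \<le> R\<close>; through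
    \<open>same\<close> it fixes the state and the scanned symbols of the whole row.\<close>
  have cR: "c t R = view (q, ts) 0" using Suc.IH[of R] TR t cf by simp
  have g: "fst (c t p') = q \<and> fst (snd (c t p')) = map read_tape ts" if "p' < 2 * R + 1" for p'
    using cR same[of t p' R] that t by (cases "p' = R") (auto simp: same_def view_def split_beta)
  have main: "fst (c (Suc t) p') = fst ?cf' \<and> snd (snd (c (Suc t) p')) = snd (snd (view ?cf' (int p' - int R)))"
    if p': "p' < 2 * R + 1" "\<bar>int p' - int R\<bar> \<le> int R - int (Suc t)" for p'
  proof (intro conjI nth_equalityI)
    show "fst (c (Suc t) p') = fst ?cf'"
      using nxt[OF t(1) p'(1) p'(1)] g[OF p'(1)] tm_step_act[OF wf] cf' by (auto simp: next_state_def split_beta)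
    have l1: "length (snd (snd (c (Suc t) p'))) = tapes M"
      using cells[of "Suc t" p'] Suc.prems p' by (auto simp: cells_def syms_def)
    have l2: "length (snd (snd (view ?cf' (int p' - int R)))) = tapes M"
      using view_cells[OF wf_config_at, of w "Suc t" "int p' - int R"] by (auto simp: cells_def syms_def split_beta)
    show "length (snd (snd (c (Suc t) p'))) = length (snd (snd (view ?cf' (int p' - int R))))"
      using l1 l2 by simp
    fix i assume "i < length (snd (snd (c (Suc t) p')))"
    then have i: "i < tapes M" using l1 by simp
    define m where "m = snd (snd (act q (map read_tape ts)) ! i)"
    \<comment> \<open>The address in the previous row of the symbol now at \<open>p'\<close>. It
      depends on the tape \<open>i\<close> through its move \<open>m\<close>, and is one step closer
      to leaving the cone at worst.\<close>
    define p where "p = nat (int p' + head_shift m)"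
    have "\<bar>head_shift m\<bar> \<le> 1" by (cases m) auto
    then have p: "int p = int p' + head_shift m" "p < 2 * R + 1" "\<bar>int p - int R\<bar> \<le> int R - int t"
      using p' by (auto simp: p_def)
    have cp: "c t p = view (q, ts) (int p - int R)" using Suc.IH[OF t(2) p(2,3)] cf by simp
    have "snd (snd (c (Suc t) p')) ! i = (if p = R then fst (snd (act q (map read_tape ts)) ! i) else snd (snd (c t p)) ! i)"
      using shift[OF t(1) p(2) p'(1) p(1)] i m_def g[OF p(2)] by (auto simp: shifted_def split_beta)
    also have "\<dots> = snd (snd (view ?cf' (int p - int R - head_shift m))) ! i"
      using view_shift[OF wf i, of "int p - int R"] cf' cp by (auto simp: m_def)
    also have "int p - int R - head_shift m = int p' - int R" using p(1) by simp
    finally show "snd (snd (c (Suc t) p')) ! i = snd (snd (view ?cf' (int p' - int R))) ! i" .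
  qed
  \<comment> \<open>The scanned symbols of the new row are those stored at its center, and
    \<open>same\<close> spreads them over the row.\<close>
  have "fst (snd (c (Suc t) R)) = snd (snd (view ?cf' 0))"
    using center[of "Suc t"] main[of R] Suc.prems TR by simp
  also have "\<dots> = fst (snd (view ?cf' 0))"
    by (auto simp: view_def read_tape_def split_beta)
  finally have "fst (snd (c (Suc t) p)) = fst (snd (view ?cf' 0))"
    using same[of "Suc t" p R] Suc.prems by (cases "p = R") (auto simp: same_def split_beta)
  then show ?case using main[of p] Suc.prems
    by (auto simp: view_def split_beta prod_eq_iff)
qed

text \<open>A halted configuration is a fixed point, so runs on witnesses of different lengths can
  all be inspected at one common time.\<close>

lemma config_at_halted:
  assumes "tm_computes_within M w v t" "t \<le> T"
  shows "fst (last (snd (config_at w T))) = content_of v"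
proof -
  have "tm_computes_within M w v (t + d)" for d
    by (induction d) (use assms(1) in \<open>auto simp: tm_computes_within_def tm_step_def\<close>)
  from this[of "T - t"] show ?thesis using assms(2) by (auto simp: tm_computes_within_def config_at_def)
qed

end

section \<open>The constraint problem of a polynomial-time verifier\<close>

locale verifier = machine M for M +
  fixes V :: "bool list set" and pM pP :: "nat poly"
  assumes decides: "\<And>w. tm_computes_within M w [w \<in> V] (poly pM (length w))"
begin

definition wit :: "bool list \<Rightarrow> nat" where
  "wit x = poly pP (length x)"

definition time :: "bool list \<Rightarrow> nat" where
  "time x = poly pM (2 * length x + 1 + wit x)"

text \<open>Two requirements: the paired input and a blank after the room for the witness fit to the
  right of the center, and at the last time the cone still has radius at least
  \<open>time x\<close>, so that it contains the output cell.\<close>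

definition rad :: "bool list \<Rightarrow> nat" where
  "rad x = 2 * time x + 2 * length x + wit x + 2"

definition width :: "bool list \<Rightarrow> nat" where
  "width x = 2 * rad x + 1"

definition vars :: "bool list \<Rightarrow> nat" where
  "vars x = (time x + 1) * width x"

definition vals :: nat where
  "vals = card cells"

text \<open>Any enumeration will do. It depends on the machine only, not on the input, so it can be
  tabulated by constants.\<close>

definition dec :: "nat \<Rightarrow> cell" where
  "dec = (SOME f. bij_betw f {0..<vals} cells)"

lemma bij_dec: "bij_betw dec {0..<vals} cells"
  unfolding dec_def vals_def using ex_bij_betw_nat_finite[OF finite_cells] by (rule someI_ex)

lemma vals_pos: "0 < vals"
  unfolding vals_def using finite_cells view_cells[OF wf_config_at, of "[]" 0 0] by (auto simp: card_gt_0_iff)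

lemma dec_cells: "a < vals \<Longrightarrow> dec a \<in> cells"
  using bij_betwE[OF bij_dec] by simp

definition sym0 :: "nat \<Rightarrow> cell \<Rightarrow> bool" where
  "sym0 s c \<longleftrightarrow> snd (snd c) ! 0 = s"

definition off_center :: "cell \<Rightarrow> bool" where
  "off_center c \<longleftrightarrow> fst (snd c) \<noteq> snd (snd c)"

text \<open>Symbol \<open>1\<close> is the bit \<open>False\<close>. An accepting output tape holds
  a single \<open>2\<close>, so this symbol can be forbidden in every cell of the last row.\<close>

definition rejecting :: "cell \<Rightarrow> bool" where
  "rejecting c \<longleftrightarrow> last (snd (snd c)) = 1"

definition non_initial :: "cell \<Rightarrow> bool" where
  "non_initial c \<longleftrightarrow> fst c \<noteq> 0 \<or> (\<exists>i<tapes M. 0 < i \<and> snd (snd c) ! i \<noteq> 0) \<or> 3 \<le> snd (snd c) ! 0"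

text \<open>Row \<open>0\<close> is prescribed except for the \<open>wit x\<close> cells after the
  separator at \<open>rad x + 2 * length x\<close>, where a witness is guessed. The disjuncts are
  split so that each applies a fixed predicate to \<open>c\<close>, which is what
  \<open>PB_cell1\<close> needs.\<close>

definition bad :: "bool list \<Rightarrow> nat \<Rightarrow> nat \<Rightarrow> cell \<Rightarrow> bool" where
  "bad x t p c \<longleftrightarrow>
     p = rad x \<and> off_center c \<or>
     t = time x \<and> rejecting c \<or>
     t = 0 \<and> (non_initial c \<or>
       p < rad x \<and> \<not> sym0 0 c \<or>
       rad x \<le> p \<and> p < rad x + 2 * length x \<and> even (p - rad x) \<and> \<not> sym0 2 c \<or>
       rad x \<le> p \<and> p < rad x + 2 * length x \<and> \<not> even (p - rad x) \<and>
         content_of x (int ((p - rad x) div 2)) = 2 \<and> \<not> sym0 2 c \<or>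
       rad x \<le> p \<and> p < rad x + 2 * length x \<and> \<not> even (p - rad x) \<and>
         \<not> content_of x (int ((p - rad x) div 2)) = 2 \<and> \<not> sym0 1 c \<or>
       p = rad x + 2 * length x \<and> \<not> sym0 1 c \<or>
       rad x + 2 * length x + wit x < p \<and> \<not> sym0 0 c)"

text \<open>The flag and the move in \<open>shifted\<close> are spelled out as constants, so that
  every predicate on cells is a fixed table. The last disjunct keeps the guessed witness contiguous:
  no bit follows a blank.\<close>

definition viol :: "bool list \<Rightarrow> nat \<Rightarrow> nat \<Rightarrow> cell \<Rightarrow> nat \<Rightarrow> nat \<Rightarrow> cell \<Rightarrow> bool" where
  "viol x t p c t' p' c' \<longleftrightarrow>
     t = t' \<and> \<not> same c c' \<or>
     t' = Suc t \<and> (\<not> next_state c c' \<or>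
       p = rad x \<and> p = Suc p' \<and> \<not> shifted True Right_Move c c' \<or>
       p \<noteq> rad x \<and> p = Suc p' \<and> \<not> shifted False Right_Move c c' \<or>
       p = rad x \<and> p = p' \<and> \<not> shifted True No_Move c c' \<or>
       p \<noteq> rad x \<and> p = p' \<and> \<not> shifted False No_Move c c' \<or>
       p = rad x \<and> Suc p = p' \<and> \<not> shifted True Left_Move c c' \<or>
       p \<noteq> rad x \<and> Suc p = p' \<and> \<not> shifted False Left_Move c c') \<or>
     t = 0 \<and> t' = 0 \<and> rad x + 2 * length x < p \<and> p' = Suc p \<and> sym0 0 c \<and> \<not> sym0 0 c'"

definition conflict :: "bool list \<Rightarrow> nat \<Rightarrow> nat \<Rightarrow> bool" where
  "conflict x e e' \<longleftrightarrow>
     bad x (e div vals div width x) (e div vals mod width x) (dec (e mod vals)) \<or>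
     e div vals = e' div vals \<or>
     viol x (e div vals div width x) (e div vals mod width x) (dec (e mod vals))
       (e' div vals div width x) (e' div vals mod width x) (dec (e' mod vals))"

lemma PT_params [pt_intros]: "PT (\<lambda>x \<rho>. wit x)" "PT (\<lambda>x \<rho>. time x)" "PT (\<lambda>x \<rho>. rad x)" "PT (\<lambda>x \<rho>. width x)" "PT (\<lambda>x \<rho>. vars x)"
proof -
  show 1: "PT (\<lambda>x \<rho>. wit x)" unfolding wit_def by (intro pt_intros)
  show 2: "PT (\<lambda>x \<rho>. time x)" unfolding time_def by (intro pt_intros 1)
  show 3: "PT (\<lambda>x \<rho>. rad x)" unfolding rad_def by (intro pt_intros 1 2)
  show 4: "PT (\<lambda>x \<rho>. width x)" unfolding width_def by (intro pt_intros 3)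
  show "PT (\<lambda>x \<rho>. vars x)" unfolding vars_def by (intro pt_intros 2 4)
qed

text \<open>The reduction modulo \<open>vals\<close> keeps both codes in the finite range of
  \<open>PB_table\<close>.\<close>

lemma PB_cell2:
  assumes "PT a" "PT b"
  shows "PB (\<lambda>x \<rho>. Q (dec (a x \<rho> mod vals)) (dec (b x \<rho> mod vals)))"
  by (rule PB_cong[OF PB_table[OF PT_mod[OF assms(1) PT_const[of vals]] PT_mod[OF assms(2) PT_const[of vals]],
        of vals vals "\<lambda>i j. Q (dec i) (dec j)"]]) (simp add: vals_pos)

lemma PB_cell1: "PT a \<Longrightarrow> PB (\<lambda>x \<rho>. Q (dec (a x \<rho> mod vals)))"
  using PB_cell2[of a a "\<lambda>c _. Q c"] by simp

lemma PB_conflict: "PT a \<Longrightarrow> PT b \<Longrightarrow> PB (\<lambda>x \<rho>. conflict x (a x \<rho>) (b x \<rho>))"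
  unfolding conflict_def bad_def viol_def
  by (intro pt_intros PB_cell1[where Q = off_center] PB_cell1[where Q = rejecting]
      PB_cell1[where Q = non_initial] PB_cell1[where Q = "sym0 _"]
      PB_cell2[where Q = same] PB_cell2[where Q = next_state] PB_cell2[where Q = "shifted _ _"])

lemma view_sym:
  assumes "i < tapes M"
  shows "snd (snd (view (config_at w t) off)) ! i =
     fst (snd (config_at w t) ! i) (snd (snd (config_at w t) ! i) + off)"
  using assms wf_config_at[of w t] by (auto simp: view_def wf_config_def split_beta)

lemma view_sym_init: "i < tapes M \<Longrightarrow> snd (snd (view (config_at w 0) off)) ! i = (if i = 0 then content_of w off else 0)"
  by (subst view_sym) (auto simp: config_at_def init_tape content_of_def)

lemma last_view:
  "last (snd (snd (view (config_at w t) off))) =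
     fst (last (snd (config_at w t))) (snd (last (snd (config_at w t))) + off)"
proof -
  have "snd (config_at w t) \<noteq> []" using wf_config_at[of w t] tapes_pos by (auto simp: wf_config_def)
  then show ?thesis by (simp add: view_def split_beta last_map)
qed

lemma accept_content:
  assumes "length y \<le> wit x"
  shows "fst (last (snd (config_at (pair_code x y) (time x)))) = content_of [pair_code x y \<in> V]"
  by (rule config_at_halted[OF decides])
    (use assms in \<open>auto simp: time_def length_pair_code intro!: poly_nat_mono\<close>)

lemma tableau_complete:
  assumes y: "length y \<le> wit x" "pair_code x y \<in> V"
  defines "c \<equiv> \<lambda>t p. view (config_at (pair_code x y) t) (int p - int (rad x))"
  shows "\<not> bad x t p (c t p)" "(t, p) \<noteq> (t', p') \<Longrightarrow> \<not> viol x t p (c t p) t' p' (c t' p')"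
proof -
  let ?w = "pair_code x y"
  have s0: "sym0 s (c 0 p) \<longleftrightarrow> content_of ?w (int p - int (rad x)) = s" for s p
    using view_sym_init[OF tapes_pos] by (simp add: sym0_def c_def)
  have neg: "content_of ?w (int p - int (rad x)) = 0" if "p < rad x" for p
    using that by (simp add: content_of_def)
  have y0: "content_of y (int j) = 0" if "wit x \<le> j" for j using y(1) that by (simp add: content_of_int)
  have 1: "\<not> off_center (c t (rad x))"
    by (auto simp: off_center_def c_def view_def split_beta read_tape_def)
  have 2: "\<not> rejecting (c (time x) p)"
    unfolding rejecting_def c_def last_view accept_content[OF y(1)] using y(2) by (simp add: content_of_def)
  have 3: "\<not> non_initial (c 0 p)"
  proof -
    have "fst (c 0 p) = 0" by (simp add: c_def view_def config_at_def tm_init_def)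
    moreover have "snd (snd (c 0 p)) ! 0 < 3"
      using view_sym_init[OF tapes_pos] content_of_less by (simp add: c_def)
    ultimately show ?thesis using view_sym_init by (auto simp: non_initial_def c_def)
  qed
  show "\<not> bad x t p (c t p)"
  proof
    assume "bad x t p (c t p)"
    then have "t = 0" and "p < rad x \<and> \<not> sym0 0 (c 0 p) \<or>
       rad x \<le> p \<and> p < rad x + 2 * length x \<and> even (p - rad x) \<and> \<not> sym0 2 (c 0 p) \<or>
       rad x \<le> p \<and> p < rad x + 2 * length x \<and> \<not> even (p - rad x) \<and>
         content_of x (int ((p - rad x) div 2)) = 2 \<and> \<not> sym0 2 (c 0 p) \<or>
       rad x \<le> p \<and> p < rad x + 2 * length x \<and> \<not> even (p - rad x) \<and>
         \<not> content_of x (int ((p - rad x) div 2)) = 2 \<and> \<not> sym0 1 (c 0 p) \<or>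
       p = rad x + 2 * length x \<and> \<not> sym0 1 (c 0 p) \<or>
       rad x + 2 * length x + wit x < p \<and> \<not> sym0 0 (c 0 p)" (is ?D)
      using 1 2 3 unfolding bad_def by auto
    show False
    proof (cases "p < rad x")
      case True
      then show False using \<open>?D\<close> s0 neg by simp
    next
      case False
      define i where "i = p - rad x"
      have p: "p = rad x + i" using False by (simp add: i_def)
      have s: "sym0 s (c 0 (rad x + i)) \<longleftrightarrow> content_of ?w (int i) = s" for s using s0[of s p] by (simp add: p)
      have "i < 2 * length x \<Longrightarrow> content_of x (int (i div 2)) \<in> {1, 2}" by (simp add: content_of_int)
      moreover have "2 * length x + wit x < i \<Longrightarrow> content_of y (int (i - Suc (2 * length x))) = 0"
        by (rule y0) simp
      ultimately show False using \<open>?D\<close> unfolding p s content_pair_code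
        by (auto split: if_splits)
    qed
  qed
  assume ne: "(t, p) \<noteq> (t', p')"
  have same: "same (c t p) (c t p')" by (simp add: same_def c_def view_def split_beta)
  have nxt: "next_state (c t p) (c (Suc t) p')"
    using wf_config_at[of ?w t] tm_step_act[of "fst (config_at ?w t)" "snd (config_at ?w t)"]
    by (simp add: next_state_def c_def view_def split_beta config_at_Suc)
  have sh: "shifted (p = rad x) m (c t p) (c (Suc t) p')" if "int p = int p' + head_shift m" for m
  proof -
    have e: "int p - int (rad x) - head_shift m = int p' - int (rad x)" "int p - int (rad x) = 0 \<longleftrightarrow> p = rad x"
      using that by auto
    show ?thesis
      using shifted_view[OF wf_config_at[of ?w t], of "int p - int (rad x)" m] unfolding c_def config_at_Suc e .
  qed
  \<comment> \<open>After the separator row \<open>0\<close> shows \<open>y\<close>, and a blank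
    there means that \<open>y\<close> has ended.\<close>
  have blank: "sym0 0 (c 0 (Suc p))" if "rad x + 2 * length x < p" "sym0 0 (c 0 p)"
  proof -
    define j where "j = p - Suc (rad x + 2 * length x)"
    have j: "p = Suc (rad x + 2 * length x) + j" using that(1) by (simp add: j_def)
    have e: "int p - int (rad x) = int (Suc (2 * length x) + j)"
      "int (Suc p) - int (rad x) = int (Suc (2 * length x) + Suc j)" using j by simp_all
    have w: "content_of ?w (int (Suc (2 * length x) + i)) = content_of y (int i)" for i
      unfolding content_pair_code by simp
    show ?thesis using that(2) unfolding s0 e w unfolding content_of_int by (simp split: if_splits)
  qed
  show "\<not> viol x t p (c t p) t' p' (c t' p')"
    unfolding viol_def using same nxt sh[of Right_Move] sh[of No_Move] sh[of Left_Move] blank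
    by (cases "t = t'"; cases "t = 0"; cases "p = rad x") auto
qed

lemma tableau_sound:
  assumes cells: "\<And>t p. t \<le> time x \<Longrightarrow> p < width x \<Longrightarrow> c t p \<in> cells"
    and nb: "\<And>t p. t \<le> time x \<Longrightarrow> p < width x \<Longrightarrow> \<not> bad x t p (c t p)"
    and nv: "\<And>t p t' p'. t \<le> time x \<Longrightarrow> p < width x \<Longrightarrow> t' \<le> time x \<Longrightarrow> p' < width x \<Longrightarrow>
      (t, p) \<noteq> (t', p') \<Longrightarrow> \<not> viol x t p (c t p) t' p' (c t' p')"
  shows "\<exists>y. length y \<le> wit x \<and> pair_code x y \<in> V"
proof -
  let ?b = "Suc (rad x + 2 * length x)"
  let ?sy = "\<lambda>p. snd (snd (c 0 p)) ! 0"
  define s where "s j = ?sy (?b + j)" for j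
  have W: "?b + wit x < width x" "rad x < width x" by (auto simp: width_def rad_def)
  have ni: "\<not> non_initial (c 0 p)" if "p < width x" for p using nb[of 0 p] that by (auto simp: bad_def)
  have s3: "s j < 3" if "?b + j < width x" for j using ni[OF that] by (auto simp: non_initial_def s_def)
  \<comment> \<open>Offset \<open>wit x\<close> is the first cell that is forced to be
    blank.\<close>
  have sP: "s (wit x) = 0" using nb[of 0 "?b + wit x"] W by (auto simp: bad_def sym0_def s_def)
  have stepz: "s (Suc j) = 0" if "s j = 0" "?b + Suc j < width x" for j
    using nv[of 0 "?b + j" 0 "?b + Suc j"] that by (auto simp: viol_def sym0_def s_def)
  \<comment> \<open>The first blank marks the end of the guessed witness.\<close>
  define l where "l = (LEAST j. s j = 0)"
  have l: "s l = 0" "l \<le> wit x" unfolding l_def using sP by (auto intro: LeastI Least_le)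
  have lless: "s j \<noteq> 0" if "j < l" for j using that not_less_Least unfolding l_def by blast
  have lge: "s j = 0" if "l \<le> j" "?b + j < width x" for j
    using that by (induction j rule: dec_induct) (auto simp: l(1) intro: stepz)
  define y where "y = map (\<lambda>j. s j = 2) [0..<l]"
  have ylen: "length y \<le> wit x" using l by (simp add: y_def)
  have cy: "content_of y (int j) = s j" if "?b + j < width x" for j
    using lless[of j] lge[of j] s3[OF that] that by (auto simp: content_of_int y_def)
  let ?w = "pair_code x y"
  have sy: "?sy p = content_of ?w (int p - int (rad x))" if p: "p < width x" for p
  proof (cases "p < rad x")
    case True
    then show ?thesis using nb[of 0 p] p by (auto simp: bad_def sym0_def content_of_def)
  next
    case False
    define i where "i = p - rad x"
    have pi: "p = rad x + i" using False by (simp add: i_def)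
    have "?sy (rad x + i) = content_of ?w (int i)"
    proof (cases "i \<le> 2 * length x")
      case True
      have "i < 2 * length x \<Longrightarrow> content_of x (int (i div 2)) \<in> {1, 2}" by (simp add: content_of_int)
      then show ?thesis using nb[of 0 "rad x + i"] p True unfolding content_pair_code
        by (auto simp: bad_def sym0_def pi split: if_splits)
    next
      case False
      then obtain j where j: "i = Suc (2 * length x) + j" by (metis less_iff_Suc_add not_le add_Suc)
      have "content_of ?w (int i) = content_of y (int j)" unfolding content_pair_code by (simp add: j)
      also have "\<dots> = s j" by (rule cy) (use p in \<open>simp add: pi j\<close>)
      finally show ?thesis by (simp add: s_def j add.assoc)
    qed
    then show ?thesis by (simp add: pi)
  qed
  have sh: "shifted (p = rad x) m (c t p) (c (Suc t) p')"
    if "t < time x" "p < width x" "p' < width x" "int p = int p' + head_shift m" for t p p' m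
  proof -
    have "\<not> viol x t p (c t p) (Suc t) p' (c (Suc t) p')" using nv[of t p "Suc t" p'] that by simp
    moreover have "m = Right_Move \<and> p = Suc p' \<or> m = No_Move \<and> p = p' \<or> m = Left_Move \<and> Suc p = p'"
      using that(4) by (cases m) auto
    ultimately show ?thesis unfolding viol_def by (cases "p = rad x") auto
  qed
  define h where "h = snd (last (snd (config_at ?w (time x))))"
  have lastnth: "last (snd (config_at ?w (time x))) = snd (config_at ?w (time x)) ! (tapes M - 1)"
    using wf_config_at[of ?w "time x"] tapes_pos by (subst last_conv_nth) (auto simp: wf_config_def split_beta)
  have "\<bar>h\<bar> \<le> int (time x)" unfolding h_def lastnth using tapes_pos by (intro config_at_head) simp
  \<comment> \<open>The address, at the last time, of cell \<open>0\<close> of the output tape,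
    whose head is at \<open>h\<close>.\<close>
  define p where "p = nat (int (rad x) - h)"
  have p: "int p = int (rad x) - h" "p < width x" "\<bar>int p - int (rad x)\<bar> \<le> int (rad x) - int (time x)"
    using \<open>\<bar>h\<bar> \<le> _\<close> by (auto simp: p_def rad_def width_def)
  have "c (time x) p = view (config_at ?w (time x)) (int p - int (rad x))"
  proof (rule light_cone[where R = "rad x" and T = "time x"])
    fix p assume p: "p < 2 * rad x + 1"
    then have pw: "p < width x" by (simp add: width_def)
    have len: "length (snd (snd (c 0 p))) = tapes M" using cells[of 0 p] pw by (auto simp: cells_def syms_def)
    have len': "length (snd (snd (view (config_at ?w 0) (int p - int (rad x))))) = tapes M"
      using view_cells[OF wf_config_at, of ?w 0 "int p - int (rad x)"] by (auto simp: cells_def syms_def)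
    have "snd (snd (c 0 p)) = snd (snd (view (config_at ?w 0) (int p - int (rad x))))"
      using len len' ni[OF pw] sy[OF pw] view_sym_init[of _ ?w]
      by (intro nth_equalityI) (auto simp: non_initial_def)
    then show "fst (c 0 p) = 0 \<and> snd (snd (c 0 p)) = snd (snd (view (config_at ?w 0) (int p - int (rad x))))"
      using ni[OF pw] by (auto simp: non_initial_def)
  next
    show "fst (snd (c t (rad x))) = snd (snd (c t (rad x)))" if "t \<le> time x" for t
      using nb[OF that W(2)] by (auto simp: bad_def off_center_def)
    show "same (c t p) (c t p')" if "t \<le> time x" "p < 2 * rad x + 1" "p' < 2 * rad x + 1" "p \<noteq> p'" for t p p'
      using nv[of t p t p'] that by (auto simp: viol_def width_def)
    show "next_state (c t p) (c (Suc t) p')" if "t < time x" "p < 2 * rad x + 1" "p' < 2 * rad x + 1" for t p p'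
      using nv[of t p "Suc t" p'] that by (auto simp: viol_def width_def)
    show "shifted (p = rad x) m (c t p) (c (Suc t) p')"
      if "t < time x" "p < 2 * rad x + 1" "p' < 2 * rad x + 1" "int p = int p' + head_shift m" for t p p' m
      using sh that by (simp add: width_def)
    show "c t p \<in> cells" if "t \<le> time x" "p < 2 * rad x + 1" for t p using cells that by (simp add: width_def)
  qed (use p in \<open>auto simp: rad_def width_def\<close>)
  then have "last (snd (snd (c (time x) p))) = content_of [?w \<in> V] 0"
    using last_view[of ?w "time x" "int p - int (rad x)"] accept_content[OF ylen] p(1) by (simp add: h_def)
  moreover have "\<not> rejecting (c (time x) p)" using nb[of "time x" p] p by (auto simp: bad_def)
  ultimately have "?w \<in> V" by (auto simp: rejecting_def content_of_def split: if_splits)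
  then show ?thesis using ylen by blast
qed

lemma vars_ge: "2 \<le> vars x"
proof -
  have "1 * 5 \<le> (time x + 1) * width x" by (intro mult_le_mono) (auto simp: width_def rad_def)
  then show ?thesis by (simp add: vars_def)
qed

text \<open>Row-major numbering identifies assignments with tableaux; \<open>csp_choice\<close> is
  then combined with \<open>tableau_sound\<close> and \<open>tableau_complete\<close>.\<close>

theorem conflict_free_iff:
  "(\<exists>X\<subseteq>{..<vars x * vals}. card X = vars x \<and> (\<forall>i\<in>X. \<forall>j\<in>X. i \<noteq> j \<longrightarrow> \<not> conflict x i j)) \<longleftrightarrow>
     (\<exists>y. length y \<le> poly pP (length x) \<and> pair_code x y \<in> V)"
proof -
  let ?W = "width x"
  let ?bad = "\<lambda>v a. bad x (v div ?W) (v mod ?W) (dec a)"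
  let ?viol = "\<lambda>v a v' a'. viol x (v div ?W) (v mod ?W) (dec a) (v' div ?W) (v' mod ?W) (dec a')"
  have W: "0 < ?W" by (simp add: width_def)
  have idx: "t * ?W + p < vars x" "(t * ?W + p) div ?W = t" "(t * ?W + p) mod ?W = p" if "t \<le> time x" "p < ?W" for t p
  proof -
    have "t * ?W + p < Suc t * ?W" using that by simp
    also have "\<dots> \<le> vars x" unfolding vars_def using that by (intro mult_le_mono1) simp
    finally show "t * ?W + p < vars x" .
  qed (use that in auto)
  have "(\<exists>X\<subseteq>{..<vars x * vals}. card X = vars x \<and> (\<forall>i\<in>X. \<forall>j\<in>X. i \<noteq> j \<longrightarrow> \<not> conflict x i j)) \<longleftrightarrow>
    (\<exists>val. (\<forall>v<vars x. val v < vals \<and> \<not> ?bad v (val v)) \<and>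
      (\<forall>v<vars x. \<forall>w<vars x. v \<noteq> w \<longrightarrow> \<not> ?viol v (val v) w (val w)))"
    by (rule csp_choice[OF vals_pos vars_ge]) (simp add: conflict_def)
  also have "\<dots> \<longleftrightarrow> (\<exists>y. length y \<le> wit x \<and> pair_code x y \<in> V)"
  proof
    assume "\<exists>val. (\<forall>v<vars x. val v < vals \<and> \<not> ?bad v (val v)) \<and>
      (\<forall>v<vars x. \<forall>w<vars x. v \<noteq> w \<longrightarrow> \<not> ?viol v (val v) w (val w))"
    then obtain val where val: "\<And>v. v < vars x \<Longrightarrow> val v < vals" "\<And>v. v < vars x \<Longrightarrow> \<not> ?bad v (val v)"
      "\<And>v w. v < vars x \<Longrightarrow> w < vars x \<Longrightarrow> v \<noteq> w \<Longrightarrow> \<not> ?viol v (val v) w (val w)" by blast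
    define c where "c t p = dec (val (t * ?W + p))" for t p
    show "\<exists>y. length y \<le> wit x \<and> pair_code x y \<in> V"
    proof (rule tableau_sound[of x c])
      fix t p assume tp: "t \<le> time x" "p < ?W"
      show "c t p \<in> cells" unfolding c_def using val(1) idx(1)[OF tp] dec_cells by blast
      show "\<not> bad x t p (c t p)" using val(2)[OF idx(1)[OF tp]] idx[OF tp] by (simp add: c_def)
      fix t' p' assume tp': "t' \<le> time x" "p' < ?W" and ne: "(t, p) \<noteq> (t', p')"
      have "t * ?W + p \<noteq> t' * ?W + p'" using ne idx(2,3)[OF tp] idx(2,3)[OF tp'] by metis
      from val(3)[OF idx(1)[OF tp] idx(1)[OF tp'] this]
      show "\<not> viol x t p (c t p) t' p' (c t' p')" using idx[OF tp] idx[OF tp'] by (simp add: c_def)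
    qed
  next
    assume "\<exists>y. length y \<le> wit x \<and> pair_code x y \<in> V"
    then obtain y where y: "length y \<le> wit x" "pair_code x y \<in> V" by blast
    define c where "c t p = view (config_at (pair_code x y) t) (int p - int (rad x))" for t p
    define val where "val v = the_inv_into {0..<vals} dec (c (v div ?W) (v mod ?W))" for v
    have cc: "c t p \<in> cells" for t p unfolding c_def by (rule view_cells[OF wf_config_at])
    have dv: "dec (val v) = c (v div ?W) (v mod ?W)" for v
      unfolding val_def using bij_dec cc by (intro f_the_inv_into_f_bij_betw) auto
    have vv: "val v < vals" for v
      using bij_betwE[OF bij_betw_the_inv_into[OF bij_dec]] cc by (auto simp: val_def)
    have ne: "(v div ?W, v mod ?W) \<noteq> (w div ?W, w mod ?W)" if "v \<noteq> w" for v w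
      using that by (metis div_mult_mod_eq prod.inject)
    show "\<exists>val. (\<forall>v<vars x. val v < vals \<and> \<not> ?bad v (val v)) \<and>
      (\<forall>v<vars x. \<forall>w<vars x. v \<noteq> w \<longrightarrow> \<not> ?viol v (val v) w (val w))"
      using vv tableau_complete[OF y] ne by (intro exI[of _ val]) (auto simp: dv c_def)
  qed
  finally show ?thesis by (simp add: wit_def)
qed

end

section \<open>Unique decoding of instances and assembly of the reduction\<close>

section \<open>The reduction\<close>

lemma pair_code_inject: "pair_code x y = pair_code x' y' \<Longrightarrow> x = x' \<and> y = y'"
proof (induction x arbitrary: x')
  case Nil
  then show ?case by (cases x') (auto simp: pair_code_def)
next
  case (Cons b x)
  then show ?case by (cases x') (auto simp: pair_code_def)
qed

lemma nat_code_inject: "nat_code m = nat_code n \<Longrightarrow> m = n"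
proof (induction m arbitrary: n rule: less_induct)
  case (less m)
  have z: "nat_code i = [] \<longleftrightarrow> i = 0" for i by (simp add: nat_code.simps)
  show ?case
  proof (cases "m = 0 \<or> n = 0")
    case True
    then show ?thesis using less.prems z by metis
  next
    case False
    then have "odd m = odd n" "nat_code (m div 2) = nat_code (n div 2)"
      using less.prems nat_code.simps[of m] nat_code.simps[of n] by auto
    moreover have "m div 2 = n div 2" by (rule less.IH) (use False calculation in auto)
    ultimately show ?thesis by (metis even_two_times_div_two odd_two_times_div_two_succ)
  qed
qed

lemma concat_rows_nth:
  "i < n \<Longrightarrow> j < n \<Longrightarrow> [f i j. i \<leftarrow> [0..<m], j \<leftarrow> [0..<n]] = [g i j. i \<leftarrow> [0..<m], j \<leftarrow> [0..<n]] \<Longrightarrow> i < m \<Longrightarrow> f i j = g i j"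
proof (induction m)
  case (Suc m)
  have len: "length [f i j. i \<leftarrow> [0..<m], j \<leftarrow> [0..<n]] = length [g i j. i \<leftarrow> [0..<m], j \<leftarrow> [0..<n]]"
    by (simp add: length_concat o_def)
  have eq: "[f i j. i \<leftarrow> [0..<m], j \<leftarrow> [0..<n]] @ map (f m) [0..<n] = [g i j. i \<leftarrow> [0..<m], j \<leftarrow> [0..<n]] @ map (g m) [0..<n]"
    using Suc.prems(3) by simp
  then have "[f i j. i \<leftarrow> [0..<m], j \<leftarrow> [0..<n]] = [g i j. i \<leftarrow> [0..<m], j \<leftarrow> [0..<n]]" "map (f m) [0..<n] = map (g m) [0..<n]"
    using append_eq_append_conv[OF disjI1[OF len]] by blast+
  then show ?case using Suc by (cases "i = m") auto
qed simp

text \<open>Membership in the yes-instances only provides some graph with the given code, so the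
  code must determine graph, capacity and threshold. Simplicity makes the matrix determine the edge
  set.\<close>

lemma LP_code_inject:
  assumes "LP_code G k s = LP_code G' k' s'" "simple_graph G" "simple_graph G'"
    and n: "verts G = {..<n}" "verts G' = {..<n'}"
  shows "k = k'" "s = s'" "verts G = verts G'" "edges G = edges G'"
proof -
  note e = assms(1)[unfolded LP_code_def graph_code_def Let_def n]
  show "k = k'" "s = s'" using e by (auto dest!: pair_code_inject nat_code_inject)
  have nn: "n = n'" and mat: "[{i, j} \<in> edges G. i \<leftarrow> [0..<n], j \<leftarrow> [0..<n]] = [{i, j} \<in> edges G'. i \<leftarrow> [0..<n'], j \<leftarrow> [0..<n']]"
    using e by (auto dest!: pair_code_inject nat_code_inject)
  show "verts G = verts G'" using n nn by simp
  have iff: "{i, j} \<in> edges G \<longleftrightarrow> {i, j} \<in> edges G'" if "i < n" "j < n" for i j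
    by (rule concat_rows_nth[of i n j "\<lambda>i j. {i, j} \<in> edges G" n "\<lambda>i j. {i, j} \<in> edges G'"]) (use that mat nn in auto)
  have dbl: "\<exists>i j. i < n \<and> j < n \<and> e = {i, j}" if "e \<subseteq> {..<n}" "card e = 2" for e
    using that by (auto simp: card_2_iff)
  have sub: "e \<subseteq> {..<n} \<and> card e = 2" if "e \<in> edges G \<or> e \<in> edges G'" for e
    using that assms(2,3) n nn by (auto simp: simple_graph_def)
  show "edges G = edges G'" using iff dbl sub by blast
qed

theorem theorem4:
  shows "NP_hard (LP_instances doubly_chordal) (LP_yes_instances doubly_chordal)"
  unfolding NP_hard_def
proof
  fix A assume "A \<in> class_NP"
  then obtain V pP where V: "V \<in> class_P"
    and A: "\<And>x. x \<in> A \<longleftrightarrow> (\<exists>y. length y \<le> poly pP (length x) \<and> pair_code x y \<in> V)"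
    unfolding class_NP_def by blast
  from V obtain M pM where "turing_machine M" "\<And>w. tm_computes_within M w [w \<in> V] (poly pM (length w))"
    unfolding class_P_def polytime_def by blast
  then interpret verifier M V pM pP by unfold_locales
  \<comment> \<open>The elements are the pairs of a tableau variable and a value, and the packing
    capacity \<open>k\<close> is the number of variables.\<close>
  define m where "m x = vars x * vals" for x
  define E where "E x v w \<longleftrightarrow> gad_arc (m x) (vars x) (conflict x) v w \<or> gad_arc (m x) (vars x) (conflict x) w v" for x v w
  define f where "f x = pair_code (nat_code (vars x)) (pair_code (nat_code (gad_s (m x) (vars x)))
     (pair_code (nat_code (gad_n (m x) (vars x))) [E x i j. i \<leftarrow> [0..<gad_n (m x) (vars x)], j \<leftarrow> [0..<gad_n (m x) (vars x)]]))" for x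
  have mpos: "0 < m x" for x using vars_ge[of x] vals_pos by (simp add: m_def)
  have PTm: "PT (\<lambda>x \<rho>. m x)" unfolding m_def by (intro pt_intros)
  have PBarc: "PB (\<lambda>x \<rho>. gad_arc (m x) (vars x) (conflict x) (\<rho> i) (\<rho> j))" for i j
    unfolding gad_arc_def gad_clique_def gad_sees_def by (intro pt_intros PTm PB_conflict)
  have poly: "polytime f"
    unfolding f_def
  proof (rule polytime_matrix_code)
    show "PT (\<lambda>x \<rho>. vars x)" by (intro pt_intros)
    show "PT (\<lambda>x \<rho>. gad_s (m x) (vars x))" unfolding gad_s_def by (intro pt_intros PTm)
    show "PT (\<lambda>x \<rho>. gad_n (m x) (vars x))" unfolding gad_n_def by (intro pt_intros PTm)
    show "PB (\<lambda>x \<rho>. E x (\<rho> 1) (\<rho> 0))" unfolding E_def by (intro PB_disj PBarc)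
  qed
  have "f x \<in> LP_instances doubly_chordal \<and> (x \<in> A \<longleftrightarrow> f x \<in> LP_yes_instances doubly_chordal)" for x
  proof -
    let ?n = "gad_n (m x) (vars x)" and ?s = "gad_s (m x) (vars x)"
    obtain G where G: "doubly_chordal G" "verts G = {..<?n}"
      "\<And>v w. v < ?n \<Longrightarrow> w < ?n \<Longrightarrow> {v, w} \<in> edges G \<longleftrightarrow> E x v w"
      "?s \<le> LP_opt G (vars x) \<longleftrightarrow>
         (\<exists>X\<subseteq>{..<m x}. card X = vars x \<and> (\<forall>i\<in>X. \<forall>j\<in>X. i \<noteq> j \<longrightarrow> \<not> conflict x i j))"
      using gadget_graph[OF mpos vars_ge, of x x "conflict x"] unfolding E_def by blast
    have simple: "simple_graph G" using G(1) by (simp add: doubly_chordal_def chordal_def)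
    have "[E x i j. i \<leftarrow> [0..<?n], j \<leftarrow> [0..<?n]] = [{i, j} \<in> edges G. i \<leftarrow> [0..<?n], j \<leftarrow> [0..<?n]]"
      using G(3) by (intro arg_cong[of _ _ concat] map_cong) auto
    then have code: "f x = LP_code G (vars x) ?s"
      by (simp add: f_def LP_code_def graph_code_def G(2) Let_def)
    have xA: "x \<in> A \<longleftrightarrow> ?s \<le> LP_opt G (vars x)"
      using A conflict_free_iff[of x] G(4) by (simp add: m_def)
    have "f x \<in> LP_yes_instances doubly_chordal \<longleftrightarrow> ?s \<le> LP_opt G (vars x)"
    proof
      assume "f x \<in> LP_yes_instances doubly_chordal"
      then obtain G' k' s' n' where G': "f x = LP_code G' k' s'" "simple_graph G'" "verts G' = {..<n'}"
        "s' \<le> LP_opt G' k'" unfolding LP_yes_instances_def by blast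
      note inj = LP_code_inject[OF G'(1)[unfolded code] simple G'(2) G(2) G'(3)]
      have "G = G'" using inj(3,4) by simp
      then show "?s \<le> LP_opt G (vars x)" using G'(4) inj(1,2) by simp
    next
      assume "?s \<le> LP_opt G (vars x)"
      then show "f x \<in> LP_yes_instances doubly_chordal"
        unfolding LP_yes_instances_def code using simple G(1,2) vars_ge by blast
    qed
    moreover have "f x \<in> LP_instances doubly_chordal"
      unfolding LP_instances_def code using simple G(1,2) vars_ge by blast
    ultimately show ?thesis using xA by blast
  qed
  then show "\<exists>f. polytime f \<and> (\<forall>x. f x \<in> LP_instances doubly_chordal \<and>
     (x \<in> A \<longleftrightarrow> f x \<in> LP_yes_instances doubly_chordal))"
    using poly by blast
qed

end
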